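(* For each $n$, assume there exists a constant $M(n)>0$ depending only on $n$ such that $$\max_{(i_1,\ldots,i_m)\in I_n^m}E\{h(X_{i_1},\ldots,X_{i_m})^{4}\}\le M(n).$$ Let $V(n)=\mathrm{Var}\{n^{-1}\sum_{i=1}^n h_{1,i}(X_i)\}$. Assume that, as $n\to\infty$, $$n^{-2}V(n)^{-1}A_{2,2}(n)M(n)^{1/2}\to 0\quad\text{and}\quad n^{-2}V(n)^{-3/2}A_{3,1}(n)M(n)^{3/4}\to 0 .$$ Then $$\mathrm{Var}(U_n)/V(n)\to 1$$ and $$\mathrm{Var}(U_n)^{-1/2}\{U_n-E(U_n)\}\stackrel{d}{\to}N(0,1).$$
   Context: Fix an integer $m\ge 1$ (with $m\ge 2$ whenever $A_{2,2}(n)$ appears, since $A_{K,q}(n)$ below is defined for $0\le q\le m$). For each $n$ let $X_1,\dots,X_n$ (short for $X_{n,1},\dots,X_{n,n}$, a triangular array) be independent random variables with values in a measurable space $(\mathcal X,\mathcal B_{\mathcal X})$, $X_i$ having distribution $P_i=P_{n,i}$; the $P_i$ need not be equal and may change with $n$. Write $[n]=\{1,\dots,n\}$. The weight function $a=a_n:\mathbb Z^m\to\mathbb R$ and the (measurable) kernel $h=h_n:\mathcal X^m\to\mathbb R$ may depend on $n$ and need not be symmetric. Let $I_n^m$ be the set of $m$-tuples $(i_1,\dots,i_m)\in[n]^m$ with pairwise distinct entries, and $$U_n=\frac{(n-m)!}{n!}\sum_{I_n^m}a(i_1,\ldots,i_m)h(X_{i_1},\ldots,X_{i_m}).$$ Let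 $\theta(i_1,\ldots,i_m)=E\{h(X_{i_1},\ldots,X_{i_m})\}$ for $(i_1,\dots,i_m)\in I_n^m$. For $l\in[m]$ let $\pi_l(y;y_1,\ldots,y_{m-1})=(y_1,\ldots,y_{l-1},y,y_l,\ldots,y_{m-1})$ and define $a^{(l)}(i;i_1,\ldots,i_{m-1})=a\{\pi_l(i;i_1,\ldots,i_{m-1})\}$, $h^{(l)}(x;x_1,\ldots,x_{m-1})=h\{\pi_l(x;x_1,\ldots,x_{m-1})\}$, $\theta^{(l)}(i;i_1,\ldots,i_{m-1})=\theta\{\pi_l(i;i_1,\ldots,i_{m-1})\}$, and $$f^{(l)}_{i_1,\ldots,i_{m-1}}(x)=\int h^{(l)}(x;y_1,\ldots,y_{m-1})\,dP_{i_1}(y_1)\cdots dP_{i_{m-1}}(y_{m-1}).$$ Let $I_{n-1}^{m-1}(-i)$ be the set of $(m-1)$-tuples of pairwise distinct elements of $[n]\setminus\{i\}$, and $$h_{1,i}(x)=\frac{(n-m)!}{(n-1)!}\sum_{I_{n-1}^{m-1}(-i)}\sum_{l=1}^m a^{(l)}(i;i_1,\ldots,i_{m-1})\big\{f^{(l)}_{i_1,\ldots,i_{m-1}}(x)-\theta^{(l)}(i;i_1,\ldots,i_{m-1})\big\}.$$ For integers $K\ge 2$, $0\le q\le m$, let $(I_n^m)_{\ge q}^{\otimes K}$ be the set of $K$-tuples $(\boldsymbol i^{(1)},\dots,\boldsymbol i^{(K)})$ of elements $\boldsymbol i^{(k)}=(i^{(k)}_1,\dots,i^{(k)}_m)\in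 I_n^m$ with $\mathrm{card}\big(\bigcap_{k=1}^K\{i_1^{(k)},\ldots,i_m^{(k)}\}\big)\ge q$, and $$A_{K,q}(n)=\frac{1}{\mathrm{card}\{(I_n^m)_{\ge q}^{\otimes K}\}}\sum_{(I_n^m)_{\ge q}^{\otimes K}}\big|a(\boldsymbol i^{(1)})\cdots a(\boldsymbol i^{(K)})\big|.$$ *)

theory Defs
  imports "HOL-Probability.Probability"
begin

text \<open>
  An \<open>m\<close>-tuple is a list of length \<open>m\<close>.  All definitions below concern a single row of the
  triangular array: \<open>N\<close> is the underlying probability space, \<open>X i\<close> (for \<open>1 \<le> i \<le> n\<close>) the
  \<open>i\<close>-th observation of the row, \<open>S\<close> the measurable space of observations, \<open>a\<close> the weight
  function on integer \<open>m\<close>-tuples and \<open>h\<close> the kernel.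
\<close>

definition dtuples :: "nat set \<Rightarrow> nat \<Rightarrow> nat list set" where
  "dtuples A m = {js. length js = m \<and> distinct js \<and> set js \<subseteq> A}"

text \<open>\<open>tuple_insert l y ys\<close> is \<open>\<pi>\<^sub>l(y; ys)\<close>; positions are counted from 1.\<close>

definition tuple_insert :: "nat \<Rightarrow> 'b \<Rightarrow> 'b list \<Rightarrow> 'b list" where
  "tuple_insert l y ys = take (l - 1) ys @ y # drop (l - 1) ys"

text \<open>
  Measurability of \<open>h : \<X>\<^sup>m \<rightarrow> \<real>\<close> for the product sigma-algebra, where \<open>\<X>\<^sup>m\<close> is identified with
  functions on \<open>{..<m}\<close>.
\<close>

definition kernel_measurable :: "'x measure \<Rightarrow> nat \<Rightarrow> ('x list \<Rightarrow> real) \<Rightarrow> bool" where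
  "kernel_measurable S m h \<longleftrightarrow>
     (\<lambda>x. h (map x [0..<m])) \<in> borel_measurable (Pi\<^sub>M {..<m} (\<lambda>_. S))"

definition ustat ::
  "(nat \<Rightarrow> 'w \<Rightarrow> 'x) \<Rightarrow> (int list \<Rightarrow> real) \<Rightarrow> ('x list \<Rightarrow> real) \<Rightarrow> nat \<Rightarrow> nat \<Rightarrow> 'w \<Rightarrow> real" where
  "ustat X a h m n \<omega> =
     fact (n - m) / fact n *
       (\<Sum>js\<in>dtuples {1..n} m. a (map int js) * h (map (\<lambda>j. X j \<omega>) js))"

definition kernel_mean ::
  "'w measure \<Rightarrow> (nat \<Rightarrow> 'w \<Rightarrow> 'x) \<Rightarrow> ('x list \<Rightarrow> real) \<Rightarrow> nat list \<Rightarrow> real" where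
  "kernel_mean N X h js = prob_space.expectation N (\<lambda>\<omega>. h (map (\<lambda>j. X j \<omega>) js))"

text \<open>
  \<open>kernel_proj N S X h l js x\<close> is \<open>f\<^sup>(\<^sup>l\<^sup>)\<close> at \<open>x\<close> for the \<open>(m-1)\<close>-tuple \<open>js\<close>: all arguments of \<open>h\<close>
  other than the \<open>l\<close>-th are integrated out with respect to the laws of \<open>X j\<close>, \<open>j\<close> in \<open>js\<close>.
\<close>

definition kernel_proj ::
  "'w measure \<Rightarrow> 'x measure \<Rightarrow> (nat \<Rightarrow> 'w \<Rightarrow> 'x) \<Rightarrow> ('x list \<Rightarrow> real) \<Rightarrow> nat \<Rightarrow> nat list \<Rightarrow> 'x \<Rightarrow> real" where
  "kernel_proj N S X h l js x =
     (\<integral>y. h (tuple_insert l x (map y [0..<length js]))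
        \<partial>Pi\<^sub>M {..<length js} (\<lambda>k. distr N S (X (js ! k))))"

definition hproj ::
  "'w measure \<Rightarrow> 'x measure \<Rightarrow> (nat \<Rightarrow> 'w \<Rightarrow> 'x) \<Rightarrow> (int list \<Rightarrow> real) \<Rightarrow> ('x list \<Rightarrow> real)
     \<Rightarrow> nat \<Rightarrow> nat \<Rightarrow> nat \<Rightarrow> 'x \<Rightarrow> real" where
  "hproj N S X a h m n i x =
     fact (n - m) / fact (n - 1) *
       (\<Sum>js\<in>dtuples ({1..n} - {i}) (m - 1). \<Sum>l=1..m.
          a (map int (tuple_insert l i js)) *
            (kernel_proj N S X h l js x - kernel_mean N X h (tuple_insert l i js)))"

definition overlap_tuples :: "nat \<Rightarrow> nat \<Rightarrow> nat \<Rightarrow> nat \<Rightarrow> nat list list set" where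
  "overlap_tuples n m K q =
     {jss. length jss = K \<and> set jss \<subseteq> dtuples {1..n} m \<and> card (\<Inter>js\<in>set jss. set js) \<ge> q}"

definition avg_weight :: "(int list \<Rightarrow> real) \<Rightarrow> nat \<Rightarrow> nat \<Rightarrow> nat \<Rightarrow> nat \<Rightarrow> real" where
  "avg_weight a m K q n =
     1 / real (card (overlap_tuples n m K q)) *
       (\<Sum>jss\<in>overlap_tuples n m K q. \<bar>\<Prod>js\<leftarrow>jss. a (map int js)\<bar>)"

end

theory Submission
  imports Defs
begin

text \<open>
  The proof is Hajek projection.  Fix a row of the array and let \<open>T\<close> be the set of admissible
  tuples.  For \<open>js \<in> T\<close> write \<open>H js\<close> for the centred observation of the kernel and \<open>D js i\<close> for its
  centred conditional mean given the \<open>i\<close>-th variable, which vanishes unless \<open>i\<close> occurs in \<open>js\<close>.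
  The centred statistic is a weighted sum \<open>Z\<close> of the \<open>H js\<close>; replacing every \<open>H js\<close> by the sum of
  the \<open>D js i\<close> over \<open>i\<close> turns it into \<open>P = (\<Sum>i. Y i)\<close>, a sum of independent variables, and \<open>Y i\<close>
  is the function \<open>h\<^sub>1\<^sub>,\<^sub>i\<close> of the informal statement at the \<open>i\<close>-th variable, divided by \<open>n\<close>
  (\<open>hproj_eq_Y\<close>).  So \<open>V\<close> is the variance of \<open>P\<close>.

  Since \<open>P\<close> is an orthogonal projection of \<open>Z\<close> (\<open>expectation_Z_P\<close>), the remainder \<open>Z - P\<close> has
  second moment \<open>Var Z - Var P\<close>.  Expanding both variances over pairs of tuples, a pair
  contributes the difference of \<open>E (H js * H ks)\<close> and \<open>\<Sum>i. E (D js i * D ks i)\<close>.  If the two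
  tuples share at most one index, this difference is zero, because the two kernel values are
  independent conditionally on the variable they share, if any (\<open>expectation_H_H_small_overlap\<close>).  The other pairs are those
  averaged in \<open>A\<^sub>2\<^sub>,\<^sub>2\<close>; there are at most of order \<open>n\<^bsup>2m-2\<^esup>\<close> of them, while the squared
  normalization is of order \<open>n\<^bsup>-2m\<^esup>\<close>.  This gives
  \<open>\<bar>Var Z - V\<bar> = O(n\<^bsup>-2\<^esup> A\<^sub>2\<^sub>,\<^sub>2 M\<^bsup>1/2\<^esup>)\<close> (\<open>variance_gap_le\<close>), hence \<open>Var Z / V \<rightarrow> 1\<close>.

  For the sum \<open>P\<close> Lyapunov's condition with third moments holds: expanding \<open>\<bar>Y i\<bar>\<^sup>3\<close> over triples of
  tuples that all contain \<open>i\<close> and summing over \<open>i\<close> counts each triple with a common index at most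
  \<open>m\<close> times, and there are at most of order \<open>n\<^bsup>3m-2\<^esup>\<close> such triples.  So
  \<open>\<Sum>i. E \<bar>Y i\<bar>\<^sup>3 = O(n\<^bsup>-2\<^esup> A\<^sub>3\<^sub>,\<^sub>1 M\<^bsup>3/4\<^esup>)\<close> (\<open>sum_third_moment_le\<close>).

  Convergence in law is proved with characteristic functions.  For a normalized sum of independent
  variables the distance to \<open>exp (- t\<^sup>2 / 2)\<close> is bounded by the sum of the third absolute moments
  (\<open>char_sum_normal_bound\<close>), and passing from \<open>P / sqrt V\<close> to \<open>Z / sqrt (Var Z)\<close> costs at most
  \<open>\<bar>t\<bar>\<close> times their \<open>L\<^sup>2\<close>-distance, which is \<open>sqrt (2 * (1 - sqrt (V / Var Z)))\<close>
  (\<open>char_normalized_bound\<close>).  Both bounds are explicit in a single row, so Levy's continuity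
  theorem finishes the proof.
\<close>

section \<open>Normal approximation of characteristic functions\<close>

lemma exp_minus_linear_bound:
  fixes x :: real
  assumes "x \<ge> 0"
  shows "\<bar>exp (- x) - (1 - x)\<bar> \<le> x\<^sup>2 / 2"
proof -
  have lo: "1 - x \<le> exp (- x)"
    using exp_ge_add_one_self[of "- x"] by simp
  have "1 \<le> (1 - x + x\<^sup>2 / 2) * (1 + x + x\<^sup>2 / 2)"
  proof -
    have "(1 - x + x\<^sup>2 / 2) * (1 + x + x\<^sup>2 / 2) = 1 + (x\<^sup>2)\<^sup>2 / 4"
      by (simp add: field_simps power2_eq_square)
    then show ?thesis by simp
  qed
  also have "\<dots> \<le> (1 - x + x\<^sup>2 / 2) * exp x"
  proof (rule mult_left_mono)
    show "1 + x + x\<^sup>2 / 2 \<le> exp x" by (rule exp_lower_Taylor_quadratic[OF assms])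
    have "0 \<le> (1 - x)\<^sup>2 + 1" by simp
    then show "0 \<le> 1 - x + x\<^sup>2 / 2" by (simp add: power2_eq_square algebra_simps)
  qed
  finally have "exp (- x) \<le> 1 - x + x\<^sup>2 / 2"
    by (simp add: exp_minus field_simps)
  with lo show ?thesis by (simp add: abs_le_iff)
qed

lemma (in prob_space) integrable_lower_powers:
  fixes f :: "'a \<Rightarrow> real"
  assumes f [measurable]: "f \<in> borel_measurable M"
    and int: "integrable M (\<lambda>\<omega>. \<bar>f \<omega>\<bar> ^ q)" and "p \<le> q"
  shows "integrable M (\<lambda>\<omega>. \<bar>f \<omega>\<bar> ^ p)" and "integrable M (\<lambda>\<omega>. f \<omega> ^ p)"
proof -
  have bd: "\<bar>x\<bar> ^ p \<le> 1 + \<bar>x\<bar> ^ q" for x :: real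
  proof (cases "\<bar>x\<bar> \<le> 1")
    case True
    then have "\<bar>x\<bar> ^ p \<le> 1" by (simp add: power_le_one)
    then show ?thesis by (smt (verit) zero_le_power abs_ge_zero)
  next
    case False
    then have "\<bar>x\<bar> ^ p \<le> \<bar>x\<bar> ^ q" using \<open>p \<le> q\<close> by (intro power_increasing) auto
    then show ?thesis by simp
  qed
  have g: "integrable M (\<lambda>\<omega>. 1 + \<bar>f \<omega>\<bar> ^ q)" using int by simp
  show "integrable M (\<lambda>\<omega>. \<bar>f \<omega>\<bar> ^ p)" "integrable M (\<lambda>\<omega>. f \<omega> ^ p)"
    by (rule Bochner_Integration.integrable_bound[OF g]; use bd in \<open>force simp: power_abs\<close>)+
qed

text \<open>
  The case \<open>\<parallel>f\<parallel>\<^sub>2 \<le> \<parallel>f\<parallel>\<^sub>3\<close> of Lyapunov's inequality, cubed.  With \<open>s = \<parallel>f\<parallel>\<^sub>2\<close> it follows by integrating the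
  tangent inequality \<open>3 s x\<^sup>2 - s\<^sup>3 \<le> 2 \<bar>x\<bar>\<^sup>3\<close>, whose defect is \<open>(\<bar>x\<bar> - s)\<^sup>2 (2 \<bar>x\<bar> + s)\<close>.
\<close>

lemma (in prob_space) second_moment_power_le_third:
  fixes f :: "'a \<Rightarrow> real"
  assumes f [measurable]: "f \<in> borel_measurable M"
    and int: "integrable M (\<lambda>\<omega>. \<bar>f \<omega>\<bar> ^ 3)"
  shows "sqrt (expectation (\<lambda>\<omega>. (f \<omega>)\<^sup>2)) ^ 3 \<le> expectation (\<lambda>\<omega>. \<bar>f \<omega>\<bar> ^ 3)"
proof -
  define s where "s = sqrt (expectation (\<lambda>\<omega>. (f \<omega>)\<^sup>2))"
  have s0: "s \<ge> 0" and s2: "s\<^sup>2 = expectation (\<lambda>\<omega>. (f \<omega>)\<^sup>2)"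
    by (auto simp: s_def)
  have int2: "integrable M (\<lambda>\<omega>. (f \<omega>)\<^sup>2)"
    using integrable_lower_powers(2)[OF f int, of 2] by simp
  have pt: "3 * s * x\<^sup>2 - s ^ 3 \<le> 2 * \<bar>x\<bar> ^ 3" for x :: real
  proof -
    have "2 * \<bar>x\<bar> ^ 3 - (3 * s * \<bar>x\<bar>\<^sup>2 - s ^ 3) = (\<bar>x\<bar> - s)\<^sup>2 * (2 * \<bar>x\<bar> + s)"
      by (simp add: power2_eq_square power3_eq_cube algebra_simps)
    also have "\<dots> \<ge> 0" using s0 by simp
    finally show ?thesis by simp
  qed
  have "3 * s * s\<^sup>2 - s ^ 3 = expectation (\<lambda>\<omega>. 3 * s * (f \<omega>)\<^sup>2 - s ^ 3)"
    using int2 by (simp add: s2 prob_space)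
  also have "\<dots> \<le> expectation (\<lambda>\<omega>. 2 * \<bar>f \<omega>\<bar> ^ 3)"
    using int int2 pt by (intro integral_mono) auto
  finally have "2 * s ^ 3 \<le> 2 * expectation (\<lambda>\<omega>. \<bar>f \<omega>\<bar> ^ 3)"
    by (simp add: power2_eq_square power3_eq_cube)
  then show ?thesis
    by (simp add: s_def)
qed

text \<open>
  A quantitative form of Lyapunov's central limit theorem.  Both characteristic functions are products
  of numbers of modulus at most 1, so their distance is at most the sum of the distances of the
  factors.  A factor of the sum is compared with a factor \<open>exp (- t\<^sup>2 v i / 2)\<close> of the normal one
  through the common second-order expansion \<open>1 - t\<^sup>2 v i / 2\<close>, where \<open>v i\<close> is the variance of \<open>Y i\<close>.
  The error of the exponential is of order \<open>(v i)\<^sup>2\<close>, which is again at most a third moment because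
  \<open>v i \<le> 1\<close>.
\<close>

lemma (in prob_space) char_sum_normal_bound:
  fixes Y :: "'i \<Rightarrow> 'a \<Rightarrow> real"
  assumes fin: "finite I"
    and indep: "indep_vars (\<lambda>_. borel) Y I"
    and int: "\<And>i. i \<in> I \<Longrightarrow> integrable M (\<lambda>\<omega>. \<bar>Y i \<omega>\<bar> ^ 3)"
    and mean: "\<And>i. i \<in> I \<Longrightarrow> expectation (Y i) = 0"
    and var: "(\<Sum>i\<in>I. expectation (\<lambda>\<omega>. (Y i \<omega>)\<^sup>2)) = 1"
  shows "cmod (char (distr M borel (\<lambda>\<omega>. \<Sum>i\<in>I. Y i \<omega>)) t - exp (- (t\<^sup>2) / 2))
           \<le> (\<bar>t\<bar> ^ 3 / 6 + t ^ 4 / 8) * (\<Sum>i\<in>I. expectation (\<lambda>\<omega>. \<bar>Y i \<omega>\<bar> ^ 3))"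
proof -
  define v where "v i = expectation (\<lambda>\<omega>. (Y i \<omega>)\<^sup>2)" for i
  define \<rho> where "\<rho> i = expectation (\<lambda>\<omega>. \<bar>Y i \<omega>\<bar> ^ 3)" for i
  define \<phi> where "\<phi> i = char (distr M borel (Y i)) t" for i
  define \<psi> where "\<psi> i = complex_of_real (exp (- (t\<^sup>2 * v i / 2)))" for i
  have rv: "random_variable borel (Y i)" if "i \<in> I" for i
    using indep that by (auto simp: indep_vars_def)
  have v0: "v i \<ge> 0" for i by (simp add: v_def)
  have v1: "v i \<le> 1" if "i \<in> I" for i
  proof -
    have "v i \<le> (\<Sum>i\<in>I. v i)" using fin that v0 by (intro member_le_sum) auto
    then show ?thesis using var by (simp add: v_def)
  qed
  have vv: "(v i)\<^sup>2 \<le> \<rho> i" if i: "i \<in> I" for i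
  proof -
    have "(v i)\<^sup>2 = sqrt (v i) ^ 3 * sqrt (v i)"
      using v0[of i] by (simp add: power2_eq_square power3_eq_cube)
    also have "\<dots> \<le> sqrt (v i) ^ 3 * 1"
      using v1[OF i] v0[of i] by (intro mult_left_mono) auto
    also have "\<dots> \<le> \<rho> i"
      unfolding v_def \<rho>_def using second_moment_power_le_third[OF rv int] i by simp
    finally show ?thesis .
  qed
  have term_bd: "cmod (\<phi> i - \<psi> i) \<le> (\<bar>t\<bar> ^ 3 / 6 + t ^ 4 / 8) * \<rho> i" if i: "i \<in> I" for i
  proof -
    note [measurable] = rv[OF i]
    have i2: "integrable M (\<lambda>\<omega>. (Y i \<omega>)\<^sup>2)" and i1: "integrable M (Y i)"
      using integrable_lower_powers(2)[OF rv int, OF i i, of 2]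
        integrable_lower_powers(2)[OF rv int, OF i i, of 1] by simp_all
    have "cmod (\<phi> i - (1 - t\<^sup>2 * v i / 2)) \<le> t\<^sup>2 / 6 *
        expectation (\<lambda>\<omega>. min (6 * (Y i \<omega>)\<^sup>2) (\<bar>t\<bar> * \<bar>Y i \<omega>\<bar> ^ 3))"
      unfolding \<phi>_def
      by (rule char_approx3'[OF rv[OF i] i1 i2 mean[OF i] _ refl]) (simp add: v_def mean i)
    also have "\<dots> \<le> t\<^sup>2 / 6 * (\<bar>t\<bar> * \<rho> i)"
    proof (rule mult_left_mono)
      have "expectation (\<lambda>\<omega>. min (6 * (Y i \<omega>)\<^sup>2) (\<bar>t\<bar> * \<bar>Y i \<omega>\<bar> ^ 3))
              \<le> expectation (\<lambda>\<omega>. \<bar>t\<bar> * \<bar>Y i \<omega>\<bar> ^ 3)"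
        using int[OF i] i2 by (intro integral_mono) auto
      then show "expectation (\<lambda>\<omega>. min (6 * (Y i \<omega>)\<^sup>2) (\<bar>t\<bar> * \<bar>Y i \<omega>\<bar> ^ 3)) \<le> \<bar>t\<bar> * \<rho> i"
        by (simp add: \<rho>_def)
    qed simp
    also have "\<dots> = \<bar>t\<bar> ^ 3 / 6 * \<rho> i"
    proof -
      have "\<bar>t\<bar> ^ 3 = t\<^sup>2 * \<bar>t\<bar>" by (simp add: power2_eq_square power3_eq_cube)
      then show ?thesis by simp
    qed
    finally have b1: "cmod (\<phi> i - (1 - t\<^sup>2 * v i / 2)) \<le> \<bar>t\<bar> ^ 3 / 6 * \<rho> i" .
    have "cmod ((1 - t\<^sup>2 * v i / 2) - \<psi> i) = \<bar>exp (- (t\<^sup>2 * v i / 2)) - (1 - t\<^sup>2 * v i / 2)\<bar>"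
      unfolding \<psi>_def by (metis abs_minus_commute norm_of_real of_real_diff)
    also have "\<dots> \<le> (t\<^sup>2 * v i / 2)\<^sup>2 / 2"
      using v0 by (intro exp_minus_linear_bound) auto
    also have "\<dots> = t ^ 4 / 8 * (v i)\<^sup>2"
      by (simp add: power_mult_distrib power_divide)
    also have "\<dots> \<le> t ^ 4 / 8 * \<rho> i"
      using vv[OF i] by (intro mult_left_mono) auto
    finally have b2: "cmod ((1 - t\<^sup>2 * v i / 2) - \<psi> i) \<le> t ^ 4 / 8 * \<rho> i" .
    have "cmod (\<phi> i - \<psi> i) \<le> cmod (\<phi> i - (1 - t\<^sup>2 * v i / 2)) + cmod ((1 - t\<^sup>2 * v i / 2) - \<psi> i)"
      using norm_triangle_ineq[of "\<phi> i - (1 - t\<^sup>2 * v i / 2)" "(1 - t\<^sup>2 * v i / 2) - \<psi> i"] by simp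
    with b1 b2 show ?thesis by (simp add: distrib_right)
  qed
  have "char (distr M borel (\<lambda>\<omega>. \<Sum>i\<in>I. Y i \<omega>)) t = (\<Prod>i\<in>I. \<phi> i)"
    unfolding \<phi>_def by (rule char_distr_sum[OF indep])
  moreover have "(\<Prod>i\<in>I. \<psi> i) = exp (- (t\<^sup>2) / 2)"
  proof -
    have "(\<Sum>i\<in>I. - (t\<^sup>2 * v i / 2)) = - (t\<^sup>2 / 2) * (\<Sum>i\<in>I. v i)"
      by (simp add: sum_distrib_left sum_negf)
    also have "\<dots> = - (t\<^sup>2) / 2" using var by (simp add: v_def)
    finally show ?thesis
      unfolding \<psi>_def using fin by (simp flip: exp_sum of_real_prod)
  qed
  ultimately have "cmod (char (distr M borel (\<lambda>\<omega>. \<Sum>i\<in>I. Y i \<omega>)) t - exp (- (t\<^sup>2) / 2))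
      = cmod ((\<Prod>i\<in>I. \<phi> i) - (\<Prod>i\<in>I. \<psi> i))" by simp
  also have "\<dots> \<le> (\<Sum>i\<in>I. cmod (\<phi> i - \<psi> i))"
  proof (rule norm_prod_diff)
    show "cmod (\<phi> i) \<le> 1" if "i \<in> I" for i
      unfolding \<phi>_def
      by (intro real_distribution.cmod_char_le_1 real_distribution_distr rv that)
    show "cmod (\<psi> i) \<le> 1" for i
      using v0[of i] by (simp add: \<psi>_def del: of_real_exp)
  qed
  also have "\<dots> \<le> (\<Sum>i\<in>I. (\<bar>t\<bar> ^ 3 / 6 + t ^ 4 / 8) * \<rho> i)"
    by (intro sum_mono term_bd)
  finally show ?thesis by (simp add: \<rho>_def sum_distrib_left)
qed

text \<open>
  This replaces Slutsky's theorem: \<open>x \<mapsto> exp (i t x)\<close> is Lipschitz with constant \<open>\<bar>t\<bar>\<close>.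
\<close>

lemma (in prob_space) char_diff_le_L2:
  fixes A B :: "'a \<Rightarrow> real"
  assumes [measurable]: "A \<in> borel_measurable M" "B \<in> borel_measurable M"
    and int: "integrable M (\<lambda>\<omega>. (A \<omega> - B \<omega>)\<^sup>2)"
  shows "cmod (char (distr M borel A) t - char (distr M borel B) t)
           \<le> \<bar>t\<bar> * sqrt (expectation (\<lambda>\<omega>. (A \<omega> - B \<omega>)\<^sup>2))"
proof -
  have i1: "integrable M (\<lambda>\<omega>. \<bar>A \<omega> - B \<omega>\<bar>)"
    using integrable_lower_powers(1)[of "\<lambda>\<omega>. A \<omega> - B \<omega>" 2 1] int by simp
  have ie: "integrable M (\<lambda>\<omega>. iexp (t * f \<omega>))" if [measurable]: "f \<in> borel_measurable M" for f
    by (intro integrable_const_bound[where B = 1]) auto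
  have "char (distr M borel A) t - char (distr M borel B) t
      = expectation (\<lambda>\<omega>. iexp (t * A \<omega>) - iexp (t * B \<omega>))"
    by (subst Bochner_Integration.integral_diff[OF ie ie])
      (simp_all add: char_def integral_distr)
  also have "cmod \<dots> \<le> expectation (\<lambda>\<omega>. cmod (iexp (t * A \<omega>) - iexp (t * B \<omega>)))"
    by (rule integral_norm_bound)
  also have "\<dots> \<le> expectation (\<lambda>\<omega>. \<bar>t\<bar> * \<bar>A \<omega> - B \<omega>\<bar>)"
  proof (rule integral_mono)
    show "cmod (iexp (t * A \<omega>) - iexp (t * B \<omega>)) \<le> \<bar>t\<bar> * \<bar>A \<omega> - B \<omega>\<bar>" for \<omega>
    proof -
      have "iexp (t * A \<omega>) - iexp (t * B \<omega>) = iexp (t * B \<omega>) * (iexp (t * (A \<omega> - B \<omega>)) - 1)"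
        by (simp add: algebra_simps flip: exp_add)
      also have "cmod \<dots> = cmod (iexp (t * (A \<omega> - B \<omega>)) - 1)"
        by (simp add: norm_mult)
      also have "\<dots> \<le> \<bar>t * (A \<omega> - B \<omega>)\<bar>"
        using iexp_approx1[of "t * (A \<omega> - B \<omega>)" 0] by simp
      finally show ?thesis by (simp add: abs_mult)
    qed
  qed (use i1 ie in \<open>auto simp del: of_real_mult
      intro!: integrable_norm Bochner_Integration.integrable_diff\<close>)
  also have "\<dots> = \<bar>t\<bar> * expectation (\<lambda>\<omega>. \<bar>A \<omega> - B \<omega>\<bar>)" by simp
  also have "\<dots> \<le> \<bar>t\<bar> * sqrt (expectation (\<lambda>\<omega>. (A \<omega> - B \<omega>)\<^sup>2))"
  proof (intro mult_left_mono real_le_rsqrt)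
    have "0 \<le> variance (\<lambda>\<omega>. \<bar>A \<omega> - B \<omega>\<bar>)" by (rule variance_positive)
    also have "\<dots> = expectation (\<lambda>\<omega>. \<bar>A \<omega> - B \<omega>\<bar>\<^sup>2) - (expectation (\<lambda>\<omega>. \<bar>A \<omega> - B \<omega>\<bar>))\<^sup>2"
      using i1 int by (intro variance_eq) auto
    finally show "(expectation (\<lambda>\<omega>. \<bar>A \<omega> - B \<omega>\<bar>))\<^sup>2 \<le> expectation (\<lambda>\<omega>. (A \<omega> - B \<omega>)\<^sup>2)"
      by simp
  qed simp
  finally show ?thesis .
qed

section \<open>Counting tuples with common elements\<close>

lemma tuple_insert_split:
  obtains us vs where "ys = us @ vs" "tuple_insert l y ys = us @ y # vs"
  by (rule that[of "take (l - 1) ys" "drop (l - 1) ys"]) (simp_all add: tuple_insert_def)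

lemma length_tuple_insert [simp]: "length (tuple_insert l y ys) = Suc (length ys)"
  by (rule tuple_insert_split[of ys l y]) simp

lemma set_tuple_insert [simp]: "set (tuple_insert l y ys) = insert y (set ys)"
  by (rule tuple_insert_split[of ys l y]) auto

lemma distinct_tuple_insert [simp]:
  "distinct (tuple_insert l y ys) \<longleftrightarrow> y \<notin> set ys \<and> distinct ys"
  by (rule tuple_insert_split[of ys l y]) auto

lemma map_tuple_insert: "map f (tuple_insert l y ys) = tuple_insert l (f y) (map f ys)"
  by (simp add: tuple_insert_def take_map drop_map)

lemma finite_dtuples [simp]: "finite A \<Longrightarrow> finite (dtuples A m)"
  by (rule finite_subset[OF _ finite_lists_length_eq[of A m]]) (auto simp: dtuples_def)

text \<open>
  The sum over \<open>(m-1)\<close>-tuples and positions in the definition of \<open>h\<^sub>1\<^sub>,\<^sub>i\<close> is a sum over the \<open>m\<close>-tuples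
  that contain \<open>i\<close>: such a tuple determines the position of \<open>i\<close>, since its entries are distinct.
\<close>

lemma bij_betw_tuple_insert:
  assumes "i \<in> A" "m \<ge> 1"
  shows "bij_betw (\<lambda>(js, l). tuple_insert l i js) (dtuples (A - {i}) (m - 1) \<times> {1..m})
           {ks \<in> dtuples A m. i \<in> set ks}"
proof (rule bij_betwI')
  fix u v assume u: "u \<in> dtuples (A - {i}) (m - 1) \<times> {1..m}" and v: "v \<in> dtuples (A - {i}) (m - 1) \<times> {1..m}"
  obtain js l where ul: "u = (js, l)" by force
  obtain ks k where vk: "v = (ks, k)" by force
  have js: "length js = m - 1" "i \<notin> set js" "1 \<le> l" "l \<le> m"
    and ks: "length ks = m - 1" "i \<notin> set ks" "1 \<le> k" "k \<le> m"
    using u v by (auto simp: ul vk dtuples_def)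
  have "u = v" if eq: "tuple_insert l i js = tuple_insert k i ks"
  proof -
    (* The only occurrence of i separates the two halves. *)
    have "take (l - 1) js = take (k - 1) ks \<and> drop (l - 1) js = drop (k - 1) ks"
      using eq js ks unfolding tuple_insert_def
      by (subst (asm) append_Cons_eq_iff) (auto dest: in_set_takeD in_set_dropD)
    moreover from this have "l - 1 = k - 1"
      using js ks by (metis diff_le_mono length_take min.absorb2)
    ultimately show ?thesis
      using js ks ul vk by (metis append_take_drop_id le_add_diff_inverse)
  qed
  then show "((case u of (js, l) \<Rightarrow> tuple_insert l i js) = (case v of (js, l) \<Rightarrow> tuple_insert l i js)) = (u = v)"
    by (auto simp: ul vk)
next
  fix u assume "u \<in> dtuples (A - {i}) (m - 1) \<times> {1..m}"
  then show "(case u of (js, l) \<Rightarrow> tuple_insert l i js) \<in> {ks \<in> dtuples A m. i \<in> set ks}"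
    using assms by (auto simp: dtuples_def)
next
  fix ks assume ks: "ks \<in> {ks \<in> dtuples A m. i \<in> set ks}"
  then obtain xs ys where xy: "ks = xs @ i # ys" by (auto dest: split_list)
  have "ks = tuple_insert (length xs + 1) i (xs @ ys)"
    by (simp add: xy tuple_insert_def)
  moreover have "(xs @ ys, length xs + 1) \<in> dtuples (A - {i}) (m - 1) \<times> {1..m}"
    using ks by (auto simp: xy dtuples_def)
  ultimately show "\<exists>u\<in>dtuples (A - {i}) (m - 1) \<times> {1..m}. ks = (case u of (js, l) \<Rightarrow> tuple_insert l i js)"
    by force
qed

text \<open>
  Each prescribed element is placed in one of at most \<open>m\<close> positions, and the remaining positions are
  filled freely.  The induction removes one prescribed element at a time from the tuple and from
  the ground set.
\<close>

lemma card_dtuples_superset_le: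
  assumes "finite F" "finite A"
  shows "card {ks \<in> dtuples A m. F \<subseteq> set ks} \<le> m ^ card F * card A ^ (m - card F)"
  using assms
proof (induction F arbitrary: A m rule: finite_induct)
  case empty
  have "card (dtuples A m) \<le> card {js. set js \<subseteq> A \<and> length js = m}"
    by (rule card_mono[OF finite_lists_length_eq[OF empty]]) (auto simp: dtuples_def)
  then show ?case by (simp add: card_lists_length_eq empty)
next
  case (insert x F)
  show ?case
  proof (cases "x \<in> A \<and> m \<ge> 1")
    case False
    then have "{ks \<in> dtuples A m. insert x F \<subseteq> set ks} = {}"
      by (auto simp: dtuples_def Suc_le_eq)
    then show ?thesis by (simp only: card.empty)
  next
    case True
    let ?B = "{js \<in> dtuples (A - {x}) (m - 1). F \<subseteq> set js}"
    have fin: "finite ?B" using insert.prems by simp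
    have "{ks \<in> dtuples A m. insert x F \<subseteq> set ks} \<subseteq> (\<lambda>(js, l). tuple_insert l x js) ` (?B \<times> {1..m})"
    proof
      fix ks assume ks: "ks \<in> {ks \<in> dtuples A m. insert x F \<subseteq> set ks}"
      then have "ks \<in> (\<lambda>(js, l). tuple_insert l x js) ` (dtuples (A - {x}) (m - 1) \<times> {1..m})"
        using bij_betw_tuple_insert[of x A m] True by (auto simp: bij_betw_def)
      then show "ks \<in> (\<lambda>(js, l). tuple_insert l x js) ` (?B \<times> {1..m})"
        using ks insert.hyps by (force simp: image_iff)
    qed
    then have "card {ks \<in> dtuples A m. insert x F \<subseteq> set ks} \<le> card (?B \<times> {1..m})"
      using fin by (meson card_image_le card_mono finite_SigmaI finite_atLeastAtMost finite_imageI le_trans)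
    also have "\<dots> = card ?B * m"
      by (subst card_cartesian_product) (simp only: card_atLeastAtMost diff_Suc_1)
    also have "\<dots> \<le> ((m - 1) ^ card F * card (A - {x}) ^ (m - 1 - card F)) * m"
      using insert.IH[of "A - {x}" "m - 1"] insert.prems by simp
    also have "\<dots> \<le> (m ^ card F * card A ^ (m - 1 - card F)) * m"
      using insert.prems by (intro mult_mono power_mono card_mono) auto
    finally show ?thesis using insert.hyps by (simp add: ac_simps)
  qed
qed

lemma finite_overlap_tuples [simp]: "finite (overlap_tuples n m K q)"
  by (rule finite_subset[OF _ finite_lists_length_eq[of "dtuples {1..n} m" K]])
    (auto simp: overlap_tuples_def)

text \<open>
  Choose \<open>q\<close> common elements in at most \<open>n\<^bsup>q\<^esup>\<close> ways; then each of the \<open>K\<close> tuples has to contain them.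
\<close>

lemma card_overlap_tuples_le:
  assumes "K \<ge> 1"
  shows "card (overlap_tuples n m K q) \<le> n ^ q * (m ^ q * n ^ (m - q)) ^ K"
proof -
  define B where "B F = {ks \<in> dtuples {1..n} m. F \<subseteq> set ks}" for F
  define \<F> where "\<F> = {F. F \<subseteq> {1..n} \<and> card F = q}"
  have "overlap_tuples n m K q \<subseteq> (\<Union>F\<in>\<F>. {jss. set jss \<subseteq> B F \<and> length jss = K})"
  proof
    fix jss assume jss: "jss \<in> overlap_tuples n m K q"
    let ?C = "\<Inter>js\<in>set jss. set js"
    have ne: "jss \<noteq> []" using jss assms by (auto simp: overlap_tuples_def)
    obtain F where F: "F \<subseteq> ?C" "card F = q"
      using jss obtain_subset_with_card_n[of q ?C] by (auto simp: overlap_tuples_def)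
    have "hd jss \<in> set jss" using ne by simp
    then have "F \<subseteq> set (hd jss)" using F by blast
    also have "\<dots> \<subseteq> {1..n}"
      using jss \<open>hd jss \<in> set jss\<close> by (auto simp: overlap_tuples_def dtuples_def)
    finally have "F \<in> \<F>" using F by (simp add: \<F>_def)
    then show "jss \<in> (\<Union>F\<in>\<F>. {jss. set jss \<subseteq> B F \<and> length jss = K})"
      using F jss by (auto simp: overlap_tuples_def B_def)
  qed
  moreover have finF: "finite \<F>" by (simp add: \<F>_def)
  moreover have finB: "finite (B F)" for F by (simp add: B_def)
  ultimately have "card (overlap_tuples n m K q)
      \<le> card (\<Union>F\<in>\<F>. {jss. set jss \<subseteq> B F \<and> length jss = K})"
    by (intro card_mono finite_UN_I finite_lists_length_eq)
  also have "\<dots> \<le> (\<Sum>F\<in>\<F>. card {jss. set jss \<subseteq> B F \<and> length jss = K})"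
    by (rule card_UN_le[OF finF])
  also have "\<dots> = (\<Sum>F\<in>\<F>. card (B F) ^ K)"
    using finB by (simp add: card_lists_length_eq)
  also have "\<dots> \<le> (\<Sum>F\<in>\<F>. (m ^ q * n ^ (m - q)) ^ K)"
  proof (intro sum_mono power_mono)
    fix F assume "F \<in> \<F>"
    then have F: "finite F" "card F = q" by (auto simp: \<F>_def intro: finite_subset)
    show "card (B F) \<le> m ^ q * n ^ (m - q)"
      using card_dtuples_superset_le[OF F(1), of "{1..n}" m] F(2) by (simp add: B_def)
  qed simp
  also have "\<dots> = (n choose q) * (m ^ q * n ^ (m - q)) ^ K"
    by (simp add: \<F>_def n_subsets)
  also have "\<dots> \<le> n ^ q * (m ^ q * n ^ (m - q)) ^ K"
  proof (rule mult_right_mono)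
    show "n choose q \<le> n ^ q"
      by (cases "q \<le> n") (auto simp: binomial_le_pow binomial_eq_0)
  qed simp
  finally show ?thesis .
qed

text \<open>
  \<open>n! / (n-m)!\<close> is at least the binomial coefficient, which is at least \<open>(n/m)\<^bsup>m\<^esup>\<close>.
\<close>

lemma falling_factorial_ratio_le:
  assumes "1 \<le> m" "m \<le> n"
  shows "fact (n - m) / fact n \<le> (real m / real n) ^ m"
proof -
  have "(real n / real m) ^ m \<le> real (n choose m)"
    by (rule binomial_ge_n_over_k_pow_k[OF assms(2)])
  also have "\<dots> = fact n / (fact m * fact (n - m))"
    by (rule binomial_fact[OF assms(2)])
  also have "\<dots> \<le> fact n / (1 * fact (n - m))"
    by (intro divide_left_mono mult_right_mono) auto
  finally have "fact (n - m) * (real n / real m) ^ m \<le> fact n"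
    by (simp add: field_simps)
  then have "fact (n - m) * (real n / real m) ^ m * (real m / real n) ^ m \<le> fact n * (real m / real n) ^ m"
    by (rule mult_right_mono) simp
  then have "fact (n - m) * ((real n / real m) ^ m * (real m / real n) ^ m) \<le> fact n * (real m / real n) ^ m"
    by (simp only: mult.assoc)
  moreover have "(real n / real m) ^ m * (real m / real n) ^ m = 1"
    using assms by (simp flip: power_mult_distrib)
  ultimately have "fact (n - m) \<le> (real m / real n) ^ m * fact n"
    by (simp only: mult_1_right mult.commute)
  then show ?thesis by (subst pos_divide_le_eq) auto
qed

text \<open>
  The two counts in which the factor \<open>n\<^bsup>-2\<^esup>\<close> of the hypotheses on \<open>V\<close> originates: \<open>q = 2\<close> common indices
  of two tuples, and one common index of three tuples, both save two powers of \<open>n\<close>.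
\<close>

lemma normalized_overlap_count_22:
  assumes "2 \<le> m" "m \<le> n"
  shows "(fact (n - m) / fact n)\<^sup>2 * real (card (overlap_tuples n m 2 2)) \<le> real m ^ (2 * m + 4) / real n ^ 2"
proof -
  have n: "real n > 0" using assms by simp
  have "(fact (n - m) / fact n)\<^sup>2 * real (card (overlap_tuples n m 2 2))
      \<le> ((real m / real n) ^ m)\<^sup>2 * real (n ^ 2 * (m ^ 2 * n ^ (m - 2)) ^ 2)"
    using assms by (intro mult_mono power_mono falling_factorial_ratio_le of_nat_mono card_overlap_tuples_le) auto
  also have "\<dots> = real m ^ (2 * m + 4) / real n ^ 2"
  proof -
    (* Writing m = p + 2 removes the truncated subtraction from the exponent. *)
    obtain p where p: "m = p + 2" using assms by (metis add.commute le_Suc_ex)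
    have "((r / s) ^ (p + 2))\<^sup>2 * (s ^ 2 * (r ^ 2 * s ^ p) ^ 2) = r ^ (2 * (p + 2) + 4) / s ^ 2"
      if "s > 0" for r s :: real
    proof -
      have "s ^ (p + 2) = s ^ p * s ^ 2" by (rule power_add)
      moreover have "r ^ (2 * (p + 2) + 4) = (r ^ (p + 2))\<^sup>2 * r ^ 4"
        by (metis power_add power_mult mult.commute)
      ultimately show ?thesis using that
        by (simp only: power_mult_distrib power_divide) (simp add: field_simps flip: power_mult)
    qed
    from this[OF n, of "real m"] show ?thesis by (simp add: p)
  qed
  finally show ?thesis .
qed

lemma normalized_overlap_count_31:
  assumes "1 \<le> m" "m \<le> n"
  shows "(fact (n - m) / fact n) ^ 3 * real (card (overlap_tuples n m 3 1)) \<le> real m ^ (3 * m + 3) / real n ^ 2"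
proof -
  have n: "real n > 0" using assms by simp
  have "(fact (n - m) / fact n) ^ 3 * real (card (overlap_tuples n m 3 1))
      \<le> ((real m / real n) ^ m) ^ 3 * real (n ^ 1 * (m ^ 1 * n ^ (m - 1)) ^ 3)"
    using assms by (intro mult_mono power_mono falling_factorial_ratio_le of_nat_mono card_overlap_tuples_le) auto
  also have "\<dots> = real m ^ (3 * m + 3) / real n ^ 2"
  proof -
    (* As before, m = p + 1 removes the truncated subtraction. *)
    obtain p where p: "m = p + 1" using assms by (metis add.commute le_Suc_ex)
    have "((r / s) ^ (p + 1)) ^ 3 * (s * (r * s ^ p) ^ 3) = r ^ (3 * (p + 1) + 3) / s ^ 2"
      if "s > 0" for r s :: real
    proof -
      have "s ^ (p + 1) = s ^ p * s" by simp
      moreover have "r ^ (3 * (p + 1) + 3) = (r ^ (p + 1)) ^ 3 * r ^ 3"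
        by (metis power_add power_mult mult.commute)
      moreover have "s ^ 3 = s * s ^ 2" by (simp add: power3_eq_cube power2_eq_square)
      ultimately show ?thesis using that
        by (simp only: power_mult_distrib power_divide) (simp add: field_simps flip: power_mult)
    qed
    from this[OF n, of "real m"] show ?thesis
      by (simp only: p add_diff_cancel_right' of_nat_mult of_nat_power power_one_right)
  qed
  finally show ?thesis .
qed

text \<open>
  Moments of linear combinations expand into iterated sums over tuples, whereas \<open>avg_weight\<close> is indexed by
  lists of tuples; restricting an iterated sum to large overlaps gives a sum over \<open>overlap_tuples\<close>.
\<close>

lemma sum_overlap_pairs:
  fixes g :: "nat list \<Rightarrow> nat list \<Rightarrow> real"
  shows "(\<Sum>js\<in>dtuples {1..n} m. \<Sum>ks\<in>dtuples {1..n} m.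
            if q \<le> card (set js \<inter> set ks) then g js ks else 0)
         = (\<Sum>jss\<in>overlap_tuples n m 2 q. g (jss ! 0) (jss ! 1))"
proof -
  let ?T = "dtuples {1..n} m"
  let ?P = "{z \<in> ?T \<times> ?T. q \<le> card (set (fst z) \<inter> set (snd z))}"
  have "(\<Sum>js\<in>?T. \<Sum>ks\<in>?T. if q \<le> card (set js \<inter> set ks) then g js ks else 0)
      = (\<Sum>z\<in>?T \<times> ?T. if q \<le> card (set (fst z) \<inter> set (snd z)) then g (fst z) (snd z) else 0)"
    by (simp add: sum.cartesian_product case_prod_beta)
  also have "\<dots> = (\<Sum>z\<in>?P. g (fst z) (snd z))"
    by (rule sum.inter_filter[symmetric]) simp
  also have "\<dots> = (\<Sum>jss\<in>overlap_tuples n m 2 q. g (jss ! 0) (jss ! 1))"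
  proof -
    have *: "[jss ! 0, jss ! 1] = jss" if "length jss = 2" for jss :: "nat list list"
      using that by (simp add: list_eq_iff_nth_eq numeral_2_eq_2 less_Suc_eq_0_disj)
    have mem: "[js, ks] \<in> overlap_tuples n m 2 q \<longleftrightarrow> (js, ks) \<in> ?P" for js ks
      by (simp add: overlap_tuples_def)
    have len: "length jss = 2" if "jss \<in> overlap_tuples n m 2 q" for jss
      using that by (simp add: overlap_tuples_def)
    show ?thesis
    proof (rule sum.reindex_bij_witness[where i = "\<lambda>jss. (jss ! 0, jss ! 1)" and j = "\<lambda>z. [fst z, snd z]"])
      fix jss assume "jss \<in> overlap_tuples n m 2 q"
      then show "[fst (jss ! 0, jss ! 1), snd (jss ! 0, jss ! 1)] = jss"
        and "(jss ! 0, jss ! 1) \<in> ?P"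
        using *[OF len] mem[of "jss ! 0" "jss ! 1"] by simp_all
    next
      fix z assume "z \<in> ?P"
      then show "[fst z, snd z] \<in> overlap_tuples n m 2 q"
        using mem[of "fst z" "snd z"] by simp
    qed simp_all
  qed
  finally show ?thesis .
qed

lemma sum_overlap_triples:
  fixes g :: "nat list \<Rightarrow> nat list \<Rightarrow> nat list \<Rightarrow> real"
  shows "(\<Sum>js\<in>dtuples {1..n} m. \<Sum>ks\<in>dtuples {1..n} m. \<Sum>ls\<in>dtuples {1..n} m.
            if q \<le> card (set js \<inter> set ks \<inter> set ls) then g js ks ls else 0)
         = (\<Sum>jss\<in>overlap_tuples n m 3 q. g (jss ! 0) (jss ! 1) (jss ! 2))"
proof -
  let ?T = "dtuples {1..n} m"
  let ?c = "\<lambda>z. q \<le> card (set (fst z) \<inter> set (fst (snd z)) \<inter> set (snd (snd z)))"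
  have "(\<Sum>js\<in>?T. \<Sum>ks\<in>?T. \<Sum>ls\<in>?T. if q \<le> card (set js \<inter> set ks \<inter> set ls) then g js ks ls else 0)
      = (\<Sum>z\<in>?T \<times> ?T \<times> ?T. if ?c z then g (fst z) (fst (snd z)) (snd (snd z)) else 0)"
    by (simp add: sum.cartesian_product case_prod_beta)
  also have "\<dots> = (\<Sum>z\<in>{z \<in> ?T \<times> ?T \<times> ?T. ?c z}. g (fst z) (fst (snd z)) (snd (snd z)))"
    by (rule sum.inter_filter[symmetric]) simp
  also have "\<dots> = (\<Sum>jss\<in>overlap_tuples n m 3 q. g (jss ! 0) (jss ! 1) (jss ! 2))"
  proof -
    have *: "[jss ! 0, jss ! 1, jss ! 2] = jss" if "length jss = 3" for jss :: "nat list list"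
      using that by (auto simp add: list_eq_iff_nth_eq numeral_3_eq_3 numeral_2_eq_2 less_Suc_eq_0_disj)
    have mem: "[js, ks, ls] \<in> overlap_tuples n m 3 q \<longleftrightarrow> (js, ks, ls) \<in> {z \<in> ?T \<times> ?T \<times> ?T. ?c z}" for js ks ls
      by (simp add: overlap_tuples_def Int_assoc)
    have len: "length jss = 3" if "jss \<in> overlap_tuples n m 3 q" for jss
      using that by (simp add: overlap_tuples_def)
    show ?thesis
    proof (rule sum.reindex_bij_witness[where i = "\<lambda>jss. (jss ! 0, jss ! 1, jss ! 2)"
          and j = "\<lambda>z. [fst z, fst (snd z), snd (snd z)]"])
      fix jss assume jss: "jss \<in> overlap_tuples n m 3 q"
      show "[fst (jss ! 0, jss ! 1, jss ! 2), fst (snd (jss ! 0, jss ! 1, jss ! 2)),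
          snd (snd (jss ! 0, jss ! 1, jss ! 2))] = jss"
        using *[OF len[OF jss]] by simp
      show "(jss ! 0, jss ! 1, jss ! 2) \<in> {z \<in> ?T \<times> ?T \<times> ?T. ?c z}"
        using jss by (simp only: *[OF len[OF jss]] flip: mem)
    next
      fix z assume "z \<in> {z \<in> ?T \<times> ?T \<times> ?T. ?c z}"
      then show "[fst z, fst (snd z), snd (snd z)] \<in> overlap_tuples n m 3 q"
        using mem[of "fst z" "fst (snd z)" "snd (snd z)"] by simp
    qed simp_all
  qed
  finally show ?thesis .
qed

lemma sum_overlap_weights:
  "(\<Sum>jss\<in>overlap_tuples n m K q. \<bar>\<Prod>js\<leftarrow>jss. a (map int js)\<bar>)
     = real (card (overlap_tuples n m K q)) * avg_weight a m K q n"
  by (simp add: avg_weight_def)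

lemma avg_weight_nonneg: "avg_weight a m K q n \<ge> 0"
  by (simp add: avg_weight_def sum_nonneg)

section \<open>Freezing one variable of the kernel\<close>

lemma kernel_measurable_map:
  assumes h: "kernel_measurable S m h" and len: "length js = m"
    and f: "\<And>j. j \<in> set js \<Longrightarrow> (\<lambda>z. f z j) \<in> measurable Z S"
  shows "(\<lambda>z. h (map (f z) js)) \<in> borel_measurable Z"
proof -
  have "(\<lambda>z. \<lambda>k\<in>{..<m}. f z (js ! k)) \<in> measurable Z (Pi\<^sub>M {..<m} (\<lambda>_. S))"
    using f len by (intro measurable_restrict) auto
  from measurable_compose[OF this h[unfolded kernel_measurable_def]]
  have "(\<lambda>z. h (map (\<lambda>k\<in>{..<m}. f z (js ! k)) [0..<m])) \<in> borel_measurable Z" .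
  moreover have "map (\<lambda>k\<in>{..<m}. f z (js ! k)) [0..<m] = map (f z) js" for z
    using len by (auto simp: list_eq_iff_nth_eq)
  ultimately show ?thesis by simp
qed

lemma kernel_measurable_power:
  "kernel_measurable S m h \<Longrightarrow> kernel_measurable S m (\<lambda>xs. h xs ^ p)"
  by (simp add: kernel_measurable_def)

text \<open>
  Fubini's theorem for the joint law of independent variables: \<open>A\<close> can be frozen while \<open>B\<close> is integrated
  out.
\<close>

lemma (in prob_space) indep_var_fubini:
  fixes F :: "'b \<times> 'b \<Rightarrow> real"
  assumes ind: "indep_var S A T B"
    and F [measurable]: "F \<in> borel_measurable (S \<Otimes>\<^sub>M T)"
    and int: "integrable M (\<lambda>\<omega>. F (A \<omega>, B \<omega>))"
  shows "AE \<omega> in M. integrable M (\<lambda>\<omega>'. F (A \<omega>, B \<omega>'))"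
    and "integrable M (\<lambda>\<omega>. \<integral>\<omega>'. F (A \<omega>, B \<omega>') \<partial>M)"
    and "expectation (\<lambda>\<omega>. F (A \<omega>, B \<omega>)) = (\<integral>\<omega>. (\<integral>\<omega>'. F (A \<omega>, B \<omega>') \<partial>M) \<partial>M)"
proof -
  have A [measurable]: "A \<in> measurable M S" and B [measurable]: "B \<in> measurable M T"
    and D: "distr M S A \<Otimes>\<^sub>M distr M T B = distr M (S \<Otimes>\<^sub>M T) (\<lambda>\<omega>. (A \<omega>, B \<omega>))"
    using ind by (auto simp: indep_var_distribution_eq)
  interpret A: prob_space "distr M S A" by (rule prob_space_distr) fact
  interpret B: prob_space "distr M T B" by (rule prob_space_distr) fact
  interpret P: pair_sigma_finite "distr M S A" "distr M T B" ..
  have intD: "integrable (distr M S A \<Otimes>\<^sub>M distr M T B) F"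
    unfolding D using int by (subst integrable_distr_eq) auto
  have inner: "(\<integral>y. F (x, y) \<partial>distr M T B) = (\<integral>\<omega>'. F (x, B \<omega>') \<partial>M)" if "x \<in> space S" for x
    using that by (subst integral_distr) auto
  have innerint: "integrable (distr M T B) (\<lambda>y. F (x, y)) \<longleftrightarrow> integrable M (\<lambda>\<omega>'. F (x, B \<omega>'))"
    if "x \<in> space S" for x
    using that by (subst integrable_distr_eq) auto
  have sp: "A \<omega> \<in> space S" if "\<omega> \<in> space M" for \<omega>
    using A that by (rule measurable_space)
  have "AE x in distr M S A. integrable (distr M T B) (\<lambda>y. F (x, y))"
    by (rule P.AE_integrable_fst'[OF intD])
  then have "AE \<omega> in M. integrable (distr M T B) (\<lambda>y. F (A \<omega>, y))"
    by (rule AE_distrD[OF A])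
  then show "AE \<omega> in M. integrable M (\<lambda>\<omega>'. F (A \<omega>, B \<omega>'))"
    by (rule AE_mp) (auto intro!: AE_I2 simp: innerint sp)
  have "integrable (distr M S A) (\<lambda>x. \<integral>y. F (x, y) \<partial>distr M T B)"
    by (rule P.integrable_fst'[OF intD])
  then have "integrable M (\<lambda>\<omega>. \<integral>y. F (A \<omega>, y) \<partial>distr M T B)"
    by (rule integrable_distr[OF A])
  then show "integrable M (\<lambda>\<omega>. \<integral>\<omega>'. F (A \<omega>, B \<omega>') \<partial>M)"
    by (rule Bochner_Integration.integrable_cong[THEN iffD1, rotated -1]) (auto simp: inner sp)
  have "expectation (\<lambda>\<omega>. F (A \<omega>, B \<omega>)) = integral\<^sup>L (distr M (S \<Otimes>\<^sub>M T) (\<lambda>\<omega>. (A \<omega>, B \<omega>))) F"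
    by (subst integral_distr) auto
  also have "\<dots> = (\<integral>x. (\<integral>y. F (x, y) \<partial>distr M T B) \<partial>distr M S A)"
    unfolding D[symmetric] by (rule P.integral_fst'[OF intD, symmetric])
  also have "\<dots> = (\<integral>\<omega>. (\<integral>y. F (A \<omega>, y) \<partial>distr M T B) \<partial>M)"
    by (rule integral_distr[OF A]) simp
  also have "\<dots> = (\<integral>\<omega>. (\<integral>\<omega>'. F (A \<omega>, B \<omega>') \<partial>M) \<partial>M)"
    by (rule Bochner_Integration.integral_cong) (auto simp: inner sp)
  finally show "expectation (\<lambda>\<omega>. F (A \<omega>, B \<omega>)) = (\<integral>\<omega>. (\<integral>\<omega>'. F (A \<omega>, B \<omega>') \<partial>M) \<partial>M)" .
qed

locale indep_sample = prob_space N for N :: "'w measure" +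
  fixes S :: "'x measure" and X :: "nat \<Rightarrow> 'w \<Rightarrow> 'x" and n :: nat
  assumes indep_X: "indep_vars (\<lambda>_. S) X {1..n}"
begin

lemma X_measurable: "j \<in> {1..n} \<Longrightarrow> X j \<in> measurable N S"
  using indep_X by (auto simp: indep_vars_def)

definition obs :: "('x list \<Rightarrow> real) \<Rightarrow> nat list \<Rightarrow> 'w \<Rightarrow> real" where
  "obs h js \<omega> = h (map (\<lambda>j. X j \<omega>) js)"

text \<open>
  The kernel observation with the \<open>i\<close>-th variable frozen at \<open>x\<close>.  Its expectation \<open>cond_mean h js i x\<close> is the
  conditional expectation of \<open>obs h js\<close> given that the \<open>i\<close>-th variable equals \<open>x\<close>.  For tuples that do
  not contain \<open>i\<close> it is the constant mean, which avoids case distinctions later on.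
\<close>

definition slice :: "('x list \<Rightarrow> real) \<Rightarrow> nat list \<Rightarrow> nat \<Rightarrow> 'x \<Rightarrow> 'w \<Rightarrow> real" where
  "slice h js i x \<omega> = h (map ((\<lambda>j. X j \<omega>)(i := x)) js)"

definition cond_mean :: "('x list \<Rightarrow> real) \<Rightarrow> nat list \<Rightarrow> nat \<Rightarrow> 'x \<Rightarrow> real" where
  "cond_mean h js i x = expectation (slice h js i x)"

context
  fixes h :: "'x list \<Rightarrow> real" and m :: nat and js :: "nat list"
  assumes h: "kernel_measurable S m h" and js: "js \<in> dtuples {1..n} m"
begin

lemma obs_measurable [measurable]: "obs h js \<in> borel_measurable N"
  unfolding obs_def using js
  by (intro kernel_measurable_map[OF h]) (auto simp: dtuples_def intro!: X_measurable)

lemma slice_measurable: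
  "x \<in> space S \<Longrightarrow> slice h js i x \<in> borel_measurable N"
  unfolding slice_def
proof (rule kernel_measurable_map[OF h])
  show "length js = m" using js by (simp add: dtuples_def)
  fix j assume "x \<in> space S" "j \<in> set js"
  then show "(\<lambda>\<omega>. ((\<lambda>j. X j \<omega>)(i := x)) j) \<in> measurable N S"
    using js by (cases "j = i") (auto simp: dtuples_def intro!: X_measurable)
qed

lemma cond_mean_measurable: "cond_mean h js i \<in> borel_measurable S"
proof -
  have "(\<lambda>z. h (map ((\<lambda>j. X j (snd z))(i := fst z)) js)) \<in> borel_measurable (S \<Otimes>\<^sub>M N)"
  proof (rule kernel_measurable_map[OF h])
    show "length js = m" using js by (simp add: dtuples_def)
    fix j assume "j \<in> set js"
    then have [measurable]: "X j \<in> measurable N S"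
      using js by (intro X_measurable) (auto simp: dtuples_def)
    show "(\<lambda>z. ((\<lambda>j. X j (snd z))(i := fst z)) j) \<in> measurable (S \<Otimes>\<^sub>M N) S"
      by (cases "j = i") simp_all
  qed
  then show ?thesis
    unfolding cond_mean_def slice_def
    by (intro borel_measurable_lebesgue_integral) (simp add: case_prod_beta)
qed

lemma cond_mean_notin: "i \<notin> set js \<Longrightarrow> cond_mean h js i x = expectation (obs h js)"
  unfolding cond_mean_def slice_def obs_def
  by (intro Bochner_Integration.integral_cong refl arg_cong[of _ _ h] map_cong) auto

text \<open>
  The tower property.  Beyond the \<open>i\<close>-th variable, \<open>\<psi>\<close> depends only on variables that do not enter
  \<open>obs h js\<close>; integrating out the variables of \<open>js\<close> other than the \<open>i\<close>-th therefore pulls \<open>\<psi>\<close> out and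
  replaces \<open>obs h js\<close> by its conditional mean.  If \<open>i\<close> does not occur in \<open>js\<close>, the conditional mean is
  constant and the lemma states that independent factors have the product of their expectations.
\<close>

lemma freeze:
  assumes A: "A \<subseteq> {1..n}" "i \<in> A" "A \<inter> set js \<subseteq> {i}"
    and \<psi> [measurable]: "\<psi> \<in> borel_measurable (Pi\<^sub>M A (\<lambda>_. S))"
    and int: "integrable N (\<lambda>\<omega>. \<psi> (\<lambda>j\<in>A. X j \<omega>) * obs h js \<omega>)"
  shows "AE \<omega> in N. integrable N (\<lambda>\<omega>'. \<psi> (\<lambda>j\<in>A. X j \<omega>) * slice h js i (X i \<omega>) \<omega>')"
    and "integrable N (\<lambda>\<omega>. \<psi> (\<lambda>j\<in>A. X j \<omega>) * cond_mean h js i (X i \<omega>))"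
    and "expectation (\<lambda>\<omega>. \<psi> (\<lambda>j\<in>A. X j \<omega>) * obs h js \<omega>)
           = expectation (\<lambda>\<omega>. \<psi> (\<lambda>j\<in>A. X j \<omega>) * cond_mean h js i (X i \<omega>))"
proof -
  let ?B = "set js - {i}"
  (* In F the i-th variable is read from the frozen vector and all others from the integrated one. *)
  define F where "F z = \<psi> (fst z) * h (map (\<lambda>j. if j = i then fst z i else snd z j) js)"
    for z :: "(nat \<Rightarrow> 'x) \<times> (nat \<Rightarrow> 'x)"
  let ?A = "\<lambda>\<omega>. \<lambda>j\<in>A. X j \<omega>" and ?R = "\<lambda>\<omega>. \<lambda>j\<in>?B. X j \<omega>"
  have ind: "indep_var (Pi\<^sub>M A (\<lambda>_. S)) ?A (Pi\<^sub>M ?B (\<lambda>_. S)) ?R"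
    using A js by (intro indep_var_restrict[OF indep_X]) (auto simp: dtuples_def)
  have "(\<lambda>z. h (map (\<lambda>j. if j = i then fst z i else snd z j) js))
          \<in> borel_measurable (Pi\<^sub>M A (\<lambda>_. S) \<Otimes>\<^sub>M Pi\<^sub>M ?B (\<lambda>_. S))"
  proof (rule kernel_measurable_map[OF h])
    show "length js = m" using js by (simp add: dtuples_def)
    fix j assume "j \<in> set js"
    then show "(\<lambda>z. if j = i then fst z i else snd z j)
        \<in> measurable (Pi\<^sub>M A (\<lambda>_. S) \<Otimes>\<^sub>M Pi\<^sub>M ?B (\<lambda>_. S)) S"
      using \<open>i \<in> A\<close>
      by (cases "j = i")
        (auto intro: measurable_compose[OF measurable_fst measurable_component_singleton]
           measurable_compose[OF measurable_snd measurable_component_singleton])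
  qed
  then have Fm: "F \<in> borel_measurable (Pi\<^sub>M A (\<lambda>_. S) \<Otimes>\<^sub>M Pi\<^sub>M ?B (\<lambda>_. S))"
    unfolding F_def by measurable
  have F2: "F (?A \<omega>, ?R \<omega>') = \<psi> (?A \<omega>) * slice h js i (X i \<omega>) \<omega>'" for \<omega> \<omega>'
  proof -
    have "map (\<lambda>j. if j = i then ?A \<omega> i else ?R \<omega>' j) js = map ((\<lambda>j. X j \<omega>')(i := X i \<omega>)) js"
      using \<open>i \<in> A\<close> by auto
    then show ?thesis by (simp only: F_def slice_def fst_conv snd_conv)
  qed
  have F1: "F (?A \<omega>, ?R \<omega>) = \<psi> (?A \<omega>) * obs h js \<omega>" for \<omega>
    unfolding F2 slice_def obs_def by (simp add: fun_upd_triv[of "\<lambda>j. X j \<omega>"])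
  have inner: "(\<integral>\<omega>'. F (?A \<omega>, ?R \<omega>') \<partial>N) = \<psi> (?A \<omega>) * cond_mean h js i (X i \<omega>)" for \<omega>
    by (simp add: F2 cond_mean_def)
  note fub = indep_var_fubini[OF ind Fm, unfolded F1, OF int]
  show "AE \<omega> in N. integrable N (\<lambda>\<omega>'. \<psi> (?A \<omega>) * slice h js i (X i \<omega>) \<omega>')"
    using fub(1) by (simp only: F2)
  show "integrable N (\<lambda>\<omega>. \<psi> (?A \<omega>) * cond_mean h js i (X i \<omega>))"
    using fub(2) by (simp only: inner)
  show "expectation (\<lambda>\<omega>. \<psi> (?A \<omega>) * obs h js \<omega>)
      = expectation (\<lambda>\<omega>. \<psi> (?A \<omega>) * cond_mean h js i (X i \<omega>))"
    using fub(3) by (simp only: inner)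
qed

lemma freeze_single:
  assumes i: "i \<in> {1..n}" and \<phi>: "\<phi> \<in> borel_measurable S"
    and int: "integrable N (\<lambda>\<omega>. \<phi> (X i \<omega>) * obs h js \<omega>)"
  shows "AE \<omega> in N. integrable N (\<lambda>\<omega>'. \<phi> (X i \<omega>) * slice h js i (X i \<omega>) \<omega>')"
    and "integrable N (\<lambda>\<omega>. \<phi> (X i \<omega>) * cond_mean h js i (X i \<omega>))"
    and "expectation (\<lambda>\<omega>. \<phi> (X i \<omega>) * obs h js \<omega>)
           = expectation (\<lambda>\<omega>. \<phi> (X i \<omega>) * cond_mean h js i (X i \<omega>))"
proof -
  have \<psi>: "(\<lambda>u. \<phi> (u i)) \<in> borel_measurable (Pi\<^sub>M {i} (\<lambda>_. S))"
    by (rule measurable_compose[OF _ \<phi>]) (simp add: measurable_component_singleton)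
  have A: "{i} \<subseteq> {1..n}" "i \<in> {i}" "{i} \<inter> set js \<subseteq> {i}"
    using i by auto
  have int': "integrable N (\<lambda>\<omega>. (\<lambda>u. \<phi> (u i)) (\<lambda>j\<in>{i}. X j \<omega>) * obs h js \<omega>)"
    using int by (simp only: restrict_apply singletonI if_True)
  show "AE \<omega> in N. integrable N (\<lambda>\<omega>'. \<phi> (X i \<omega>) * slice h js i (X i \<omega>) \<omega>')"
    "integrable N (\<lambda>\<omega>. \<phi> (X i \<omega>) * cond_mean h js i (X i \<omega>))"
    "expectation (\<lambda>\<omega>. \<phi> (X i \<omega>) * obs h js \<omega>)
           = expectation (\<lambda>\<omega>. \<phi> (X i \<omega>) * cond_mean h js i (X i \<omega>))"
    using freeze[OF A \<psi> int'] by (simp_all only: restrict_apply singletonI if_True)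
qed

end

text \<open>
  The product of the laws of the variables indexed by \<open>js\<close> is the law of their vector, so integrating the
  kernel against it is taking an expectation with the \<open>i\<close>-th variable frozen.
\<close>

lemma kernel_proj_eq_cond_mean:
  assumes h: "kernel_measurable S m h" and m: "m \<ge> 2"
    and js: "js \<in> dtuples ({1..n} - {i}) (m - 1)" and x: "x \<in> space S"
  shows "kernel_proj N S X h l js x = cond_mean h (tuple_insert l i js) i x"
proof -
  let ?p = "length js"
  have len: "?p = m - 1" and dist: "distinct js" and sub: "set js \<subseteq> {1..n}" and ni: "i \<notin> set js"
    using js by (auto simp: dtuples_def)
  have Xj: "X (js ! k) \<in> measurable N S" if "k \<in> {..<?p}" for k
    using that sub nth_mem[of k js] by (intro X_measurable) blast
  have ind: "indep_vars (\<lambda>_. S) (\<lambda>k. X (js ! k)) {..<?p}"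
  proof -
    have "indep_vars (\<lambda>k. Pi\<^sub>M {js ! k} (\<lambda>_. S)) (\<lambda>k \<omega>. \<lambda>j\<in>{js ! k}. X j \<omega>) {..<?p}"
    proof (rule indep_vars_restrict[OF indep_X])
      show "{js ! k} \<subseteq> {1..n}" if "k \<in> {..<?p}" for k
        using that sub nth_mem[of k js] by blast
      show "disjoint_family_on (\<lambda>k. {js ! k}) {..<?p}"
        using dist by (auto simp: disjoint_family_on_def nth_eq_iff_index_eq)
    qed
    then have "indep_vars (\<lambda>_. S) (\<lambda>k \<omega>. (\<lambda>u. u (js ! k)) (\<lambda>j\<in>{js ! k}. X j \<omega>)) {..<?p}"
      by (rule indep_vars_compose2) (simp add: measurable_component_singleton)
    then show ?thesis by simp
  qed
  have ne: "{..<?p} \<noteq> {}" using m len by (simp add: lessThan_empty_iff)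
  have D: "Pi\<^sub>M {..<?p} (\<lambda>k. distr N S (X (js ! k)))
      = distr N (Pi\<^sub>M {..<?p} (\<lambda>_. S)) (\<lambda>\<omega>. \<lambda>k\<in>{..<?p}. X (js ! k) \<omega>)"
    by (rule indep_vars_iff_distr_eq_PiM'[OF ne Xj, THEN iffD1, OF _ ind, symmetric])
  have meas: "(\<lambda>y. h (tuple_insert l x (map y [0..<?p]))) \<in> borel_measurable (Pi\<^sub>M {..<?p} (\<lambda>_. S))"
  proof -
    have "(\<lambda>y. h (map (\<lambda>k. if k = ?p then x else y k) (tuple_insert l ?p [0..<?p])))
        \<in> borel_measurable (Pi\<^sub>M {..<?p} (\<lambda>_. S))"
    proof (rule kernel_measurable_map[OF h])
      show "length (tuple_insert l ?p [0..<?p]) = m" using m len by simp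
      fix k assume "k \<in> set (tuple_insert l ?p [0..<?p])"
      then show "(\<lambda>y. if k = ?p then x else y k) \<in> measurable (Pi\<^sub>M {..<?p} (\<lambda>_. S)) S"
        using x by (cases "k = ?p") (auto intro: measurable_component_singleton)
    qed
    moreover have "map (\<lambda>k. if k = ?p then x else y k) (tuple_insert l ?p [0..<?p])
        = tuple_insert l x (map y [0..<?p])" for y
      unfolding map_tuple_insert by (auto intro!: arg_cong[of _ _ "tuple_insert l x"])
    ultimately show ?thesis by (simp only:)
  qed
  have "kernel_proj N S X h l js x
      = expectation (\<lambda>\<omega>. h (tuple_insert l x (map (\<lambda>k\<in>{..<?p}. X (js ! k) \<omega>) [0..<?p])))"
    unfolding kernel_proj_def D
    by (rule integral_distr[OF measurable_restrict meas]) (rule Xj)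
  also have "\<dots> = expectation (slice h (tuple_insert l i js) i x)"
  proof (rule Bochner_Integration.integral_cong[OF refl])
    fix \<omega>
    have "map (\<lambda>k\<in>{..<?p}. X (js ! k) \<omega>) [0..<?p] = map ((\<lambda>j. X j \<omega>)(i := x)) js"
    proof (rule nth_equalityI)
      fix k assume "k < length (map (\<lambda>k\<in>{..<?p}. X (js ! k) \<omega>) [0..<?p])"
      then have "k < ?p" by simp
      moreover from this have "js ! k \<noteq> i" using ni nth_mem[of k js] by auto
      ultimately show "map (\<lambda>k\<in>{..<?p}. X (js ! k) \<omega>) [0..<?p] ! k
          = map ((\<lambda>j. X j \<omega>)(i := x)) js ! k" by simp
    qed simp
    then show "h (tuple_insert l x (map (\<lambda>k\<in>{..<?p}. X (js ! k) \<omega>) [0..<?p]))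
        = slice h (tuple_insert l i js) i x \<omega>"
      by (simp only: slice_def map_tuple_insert fun_upd_same)
  qed
  finally show ?thesis by (simp add: cond_mean_def)
qed

end

section \<open>Variables with a finite fourth moment\<close>

lemma add_power4_le: "(x + y) ^ 4 \<le> 8 * (x ^ 4 + y ^ 4)" for x y :: real
proof -
  have "8 * (x ^ 4 + y ^ 4) - (x + y) ^ 4 = (x - y)\<^sup>2 * (5 * (x + y)\<^sup>2 + 2 * x\<^sup>2 + 2 * y\<^sup>2)"
    by algebra
  also have "\<dots> \<ge> 0" by simp
  finally show ?thesis by simp
qed

text \<open>
  A homogeneous way to bound lower moments by the fourth one: for \<open>s\<^sup>4\<close> of the order of the fourth moment
  both terms on the right have expectation of order \<open>s\<^bsup>p\<^esup>\<close>.
\<close>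

lemma power_le_scaled_power4:
  fixes x s :: real
  assumes "s > 0" "p \<le> 4"
  shows "\<bar>x\<bar> ^ p \<le> x ^ 4 / s ^ (4 - p) + s ^ p"
proof (cases "\<bar>x\<bar> \<le> s")
  case True
  then have "\<bar>x\<bar> ^ p \<le> s ^ p" by (intro power_mono) auto
  also have "\<dots> \<le> x ^ 4 / s ^ (4 - p) + s ^ p" using assms by simp
  finally show ?thesis .
next
  case False
  then have "\<bar>x\<bar> ^ p * s ^ (4 - p) \<le> \<bar>x\<bar> ^ p * \<bar>x\<bar> ^ (4 - p)"
    using assms by (intro mult_left_mono power_mono) auto
  also have "\<dots> = x ^ 4" using assms by (simp flip: power_add)
  finally have "\<bar>x\<bar> ^ p \<le> x ^ 4 / s ^ (4 - p)" using assms by (simp add: field_simps)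
  also have "\<dots> \<le> x ^ 4 / s ^ (4 - p) + s ^ p" using assms by simp
  finally show ?thesis .
qed

context prob_space
begin

text \<open>
  The class of variables with a finite fourth moment.  It is closed under linear combinations, and
  products of up to three members are integrable, as second and third moments of linear combinations
  require.
\<close>

definition L4 :: "('a \<Rightarrow> real) \<Rightarrow> bool" where
  "L4 f \<longleftrightarrow> f \<in> borel_measurable M \<and> integrable M (\<lambda>\<omega>. f \<omega> ^ 4)"

lemma L4_measurable: "L4 f \<Longrightarrow> f \<in> borel_measurable M"
  by (simp add: L4_def)

lemma L4_const: "L4 (\<lambda>_. k)"
  by (simp add: L4_def)

lemma L4_scale: "L4 f \<Longrightarrow> L4 (\<lambda>\<omega>. k * f \<omega>)"
  by (auto simp: L4_def power_mult_distrib)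

lemma L4_add: "L4 f \<Longrightarrow> L4 g \<Longrightarrow> L4 (\<lambda>\<omega>. f \<omega> + g \<omega>)"
  unfolding L4_def
proof safe
  assume [measurable]: "f \<in> borel_measurable M" "g \<in> borel_measurable M"
    and f4: "integrable M (\<lambda>\<omega>. f \<omega> ^ 4)" and g4: "integrable M (\<lambda>\<omega>. g \<omega> ^ 4)"
  show "(\<lambda>\<omega>. f \<omega> + g \<omega>) \<in> borel_measurable M" by simp
  show "integrable M (\<lambda>\<omega>. (f \<omega> + g \<omega>) ^ 4)"
  proof (rule Bochner_Integration.integrable_bound)
    show "integrable M (\<lambda>\<omega>. 8 * (f \<omega> ^ 4 + g \<omega> ^ 4))" using f4 g4 by simp
  qed (use add_power4_le in \<open>auto intro!: AE_I2\<close>)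
qed

lemma L4_diff: "L4 f \<Longrightarrow> L4 g \<Longrightarrow> L4 (\<lambda>\<omega>. f \<omega> - g \<omega>)"
  using L4_add[of f "\<lambda>\<omega>. (-1) * g \<omega>"] L4_scale[of g "-1"] by simp

lemma L4_sum: "(\<And>i. i \<in> I \<Longrightarrow> L4 (f i)) \<Longrightarrow> L4 (\<lambda>\<omega>. \<Sum>i\<in>I. f i \<omega>)"
  by (induction I rule: infinite_finite_induct) (auto simp: L4_const intro!: L4_add)

lemma L4_integrable_abs_power: "L4 f \<Longrightarrow> p \<le> 4 \<Longrightarrow> integrable M (\<lambda>\<omega>. \<bar>f \<omega>\<bar> ^ p)"
  and L4_integrable_power: "L4 f \<Longrightarrow> p \<le> 4 \<Longrightarrow> integrable M (\<lambda>\<omega>. f \<omega> ^ p)"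
  using integrable_lower_powers[of f 4 p] by (auto simp: L4_def)

lemma L4_integrable: "L4 f \<Longrightarrow> integrable M f"
  using L4_integrable_power[of f 1] by simp

lemma L4_integrable_mult: "L4 f \<Longrightarrow> L4 g \<Longrightarrow> integrable M (\<lambda>\<omega>. f \<omega> * g \<omega>)"
proof (rule Bochner_Integration.integrable_bound)
  assume f: "L4 f" and g: "L4 g"
  note [measurable] = L4_measurable[OF f] L4_measurable[OF g]
  show "integrable M (\<lambda>\<omega>. (f \<omega>)\<^sup>2 + (g \<omega>)\<^sup>2)"
    using L4_integrable_power[OF f, of 2] L4_integrable_power[OF g, of 2] by simp
  show "(\<lambda>\<omega>. f \<omega> * g \<omega>) \<in> borel_measurable M" by simp
  have "\<bar>x * y\<bar> \<le> x\<^sup>2 + y\<^sup>2" for x y :: real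
  proof -
    have "2 * \<bar>x * y\<bar> \<le> x\<^sup>2 + y\<^sup>2"
      using sum_squares_bound[of "\<bar>x\<bar>" "\<bar>y\<bar>"] by (simp add: abs_mult)
    then show ?thesis using abs_ge_zero[of "x * y"] by linarith
  qed
  then show "AE \<omega> in M. norm (f \<omega> * g \<omega>) \<le> norm ((f \<omega>)\<^sup>2 + (g \<omega>)\<^sup>2)" by (intro AE_I2) simp
qed

text \<open>
  Jensen's inequality, as two applications of the nonnegativity of a variance.
\<close>

lemma expectation_power4_le:
  assumes "L4 f"
  shows "(expectation f) ^ 4 \<le> expectation (\<lambda>\<omega>. f \<omega> ^ 4)"
proof -
  have sq: "(expectation g)\<^sup>2 \<le> expectation (\<lambda>\<omega>. (g \<omega>)\<^sup>2)"
    if "integrable M g" "integrable M (\<lambda>\<omega>. (g \<omega>)\<^sup>2)" for g :: "'a \<Rightarrow> real"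
    using variance_positive[of g] variance_eq[OF that] by simp
  have "(expectation f) ^ 4 = ((expectation f)\<^sup>2)\<^sup>2" by simp
  also have "\<dots> \<le> (expectation (\<lambda>\<omega>. (f \<omega>)\<^sup>2))\<^sup>2"
    using L4_integrable[OF assms] L4_integrable_power[OF assms, of 2] by (intro power_mono sq) auto
  also have "\<dots> \<le> expectation (\<lambda>\<omega>. ((f \<omega>)\<^sup>2)\<^sup>2)"
    using L4_integrable_power[OF assms, of 2] L4_integrable_power[OF assms, of 4]
    by (intro sq) simp_all
  finally show ?thesis by simp
qed

text \<open>
  The factor 16 is what centring costs for fourth moments, see \<open>centered_power4_le\<close> below; the
  bound is \<open>power_le_scaled_power4\<close> with \<open>s = K\<^bsup>1/4\<^esup>\<close>, and \<open>17 = 16 + 1\<close>.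
\<close>

lemma abs_moment_le_of_fourth_moment:
  assumes f: "L4 f" and le: "expectation (\<lambda>\<omega>. f \<omega> ^ 4) \<le> 16 * K" and K: "K > 0" and p: "p \<le> 4"
  shows "expectation (\<lambda>\<omega>. \<bar>f \<omega>\<bar> ^ p) \<le> 17 * K powr (real p / 4)"
proof -
  define s where "s = K powr (1 / 4)"
  have s: "s > 0" using K by (simp add: s_def)
  have pw: "s ^ q = K powr (real q / 4)" for q
    using K by (simp add: s_def powr_powr flip: powr_realpow)
  have s4: "s ^ 4 = K" using K by (simp add: pw)
  have "expectation (\<lambda>\<omega>. \<bar>f \<omega>\<bar> ^ p) \<le> expectation (\<lambda>\<omega>. f \<omega> ^ 4 / s ^ (4 - p) + s ^ p)"
    using L4_integrable_power[OF f, of 4] L4_integrable_abs_power[OF f p]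
    by (intro integral_mono power_le_scaled_power4 s p) auto
  also have "\<dots> = expectation (\<lambda>\<omega>. f \<omega> ^ 4) / s ^ (4 - p) + s ^ p"
    using L4_integrable_power[OF f, of 4] by (simp add: prob_space)
  also have "\<dots> \<le> 16 * s ^ 4 / s ^ (4 - p) + s ^ p"
    using le s by (intro add_right_mono divide_right_mono) (simp_all add: s4)
  also have "s ^ 4 = s ^ p * s ^ (4 - p)" using p by (simp flip: power_add)
  finally have "expectation (\<lambda>\<omega>. \<bar>f \<omega>\<bar> ^ p) \<le> 17 * s ^ p" using s by simp
  then show ?thesis by (simp add: pw)
qed

lemma abs_expectation_mult_le:
  assumes "L4 f" "L4 g" "expectation (\<lambda>\<omega>. (f \<omega>)\<^sup>2) \<le> B" "expectation (\<lambda>\<omega>. (g \<omega>)\<^sup>2) \<le> B"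
  shows "\<bar>expectation (\<lambda>\<omega>. f \<omega> * g \<omega>)\<bar> \<le> B"
proof -
  note f2 = L4_integrable_power[OF assms(1), of 2, simplified]
  note g2 = L4_integrable_power[OF assms(2), of 2, simplified]
  have "\<bar>expectation (\<lambda>\<omega>. f \<omega> * g \<omega>)\<bar> \<le> expectation (\<lambda>\<omega>. \<bar>f \<omega> * g \<omega>\<bar>)"
    by (rule integral_abs_bound)
  also have "\<dots> \<le> expectation (\<lambda>\<omega>. ((f \<omega>)\<^sup>2 + (g \<omega>)\<^sup>2) / 2)"
  proof (rule integral_mono)
    show "\<bar>f \<omega> * g \<omega>\<bar> \<le> ((f \<omega>)\<^sup>2 + (g \<omega>)\<^sup>2) / 2" for \<omega>
      using sum_squares_bound[of "\<bar>f \<omega>\<bar>" "\<bar>g \<omega>\<bar>"] by (simp add: abs_mult)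
  qed (use L4_integrable_mult[OF assms(1,2)] f2 g2 in auto)
  also have "\<dots> = (expectation (\<lambda>\<omega>. (f \<omega>)\<^sup>2) + expectation (\<lambda>\<omega>. (g \<omega>)\<^sup>2)) / 2"
    using f2 g2 by simp
  finally show ?thesis using assms(3,4) by simp
qed

lemma expectation_abs_mult3_le:
  assumes "L4 f" "L4 g" "L4 k"
    and "expectation (\<lambda>\<omega>. \<bar>f \<omega>\<bar> ^ 3) \<le> B" "expectation (\<lambda>\<omega>. \<bar>g \<omega>\<bar> ^ 3) \<le> B"
      "expectation (\<lambda>\<omega>. \<bar>k \<omega>\<bar> ^ 3) \<le> B"
  shows "integrable M (\<lambda>\<omega>. \<bar>f \<omega>\<bar> * \<bar>g \<omega>\<bar> * \<bar>k \<omega>\<bar>)"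
    and "expectation (\<lambda>\<omega>. \<bar>f \<omega>\<bar> * \<bar>g \<omega>\<bar> * \<bar>k \<omega>\<bar>) \<le> 3 * B"
proof -
  note [measurable] = assms(1-3)[THEN L4_measurable]
  have bd: "\<bar>x\<bar> * \<bar>y\<bar> * \<bar>z\<bar> \<le> \<bar>x\<bar> ^ 3 + \<bar>y\<bar> ^ 3 + \<bar>z\<bar> ^ 3" for x y z :: real
  proof -
    define u where "u = max \<bar>x\<bar> (max \<bar>y\<bar> \<bar>z\<bar>)"
    have "\<bar>x\<bar> * \<bar>y\<bar> * \<bar>z\<bar> \<le> u * u * u"
      by (intro mult_mono) (auto simp: u_def)
    also have "\<dots> = u ^ 3" by (simp add: power3_eq_cube)
    also have "\<dots> \<le> \<bar>x\<bar> ^ 3 + \<bar>y\<bar> ^ 3 + \<bar>z\<bar> ^ 3"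
    proof -
      have "u = \<bar>x\<bar> \<or> u = \<bar>y\<bar> \<or> u = \<bar>z\<bar>" by (auto simp: u_def max_def)
      moreover have "0 \<le> \<bar>x\<bar> ^ 3" "0 \<le> \<bar>y\<bar> ^ 3" "0 \<le> \<bar>z\<bar> ^ 3" by (rule zero_le_power, simp)+
      moreover from calculation(1) have "u ^ 3 = \<bar>x\<bar> ^ 3 \<or> u ^ 3 = \<bar>y\<bar> ^ 3 \<or> u ^ 3 = \<bar>z\<bar> ^ 3" by metis
      ultimately show ?thesis by linarith
    qed
    finally show ?thesis .
  qed
  have int: "integrable M (\<lambda>\<omega>. \<bar>f \<omega>\<bar> ^ 3 + \<bar>g \<omega>\<bar> ^ 3 + \<bar>k \<omega>\<bar> ^ 3)"
    using assms(1-3)[THEN L4_integrable_abs_power, of 3] by simp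
  show i: "integrable M (\<lambda>\<omega>. \<bar>f \<omega>\<bar> * \<bar>g \<omega>\<bar> * \<bar>k \<omega>\<bar>)"
  proof (rule Bochner_Integration.integrable_bound[OF int])
    show "AE \<omega> in M. norm (\<bar>f \<omega>\<bar> * \<bar>g \<omega>\<bar> * \<bar>k \<omega>\<bar>) \<le> norm (\<bar>f \<omega>\<bar> ^ 3 + \<bar>g \<omega>\<bar> ^ 3 + \<bar>k \<omega>\<bar> ^ 3)"
    proof (rule AE_I2)
      fix \<omega>
      have "norm (\<bar>f \<omega>\<bar> * \<bar>g \<omega>\<bar> * \<bar>k \<omega>\<bar>) = \<bar>f \<omega>\<bar> * \<bar>g \<omega>\<bar> * \<bar>k \<omega>\<bar>"
        by (simp add: abs_mult)
      then show "norm (\<bar>f \<omega>\<bar> * \<bar>g \<omega>\<bar> * \<bar>k \<omega>\<bar>) \<le> norm (\<bar>f \<omega>\<bar> ^ 3 + \<bar>g \<omega>\<bar> ^ 3 + \<bar>k \<omega>\<bar> ^ 3)"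
        using bd[of "f \<omega>" "g \<omega>" "k \<omega>"] abs_ge_self by (simp only: real_norm_def) (rule order_trans)
    qed
  qed measurable
  have "expectation (\<lambda>\<omega>. \<bar>f \<omega>\<bar> * \<bar>g \<omega>\<bar> * \<bar>k \<omega>\<bar>)
      \<le> expectation (\<lambda>\<omega>. \<bar>f \<omega>\<bar> ^ 3 + \<bar>g \<omega>\<bar> ^ 3 + \<bar>k \<omega>\<bar> ^ 3)"
    by (intro integral_mono i int bd)
  also have "\<dots> = expectation (\<lambda>\<omega>. \<bar>f \<omega>\<bar> ^ 3) + expectation (\<lambda>\<omega>. \<bar>g \<omega>\<bar> ^ 3) + expectation (\<lambda>\<omega>. \<bar>k \<omega>\<bar> ^ 3)"
    using assms(1-3)[THEN L4_integrable_abs_power, of 3] by simp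
  finally show "expectation (\<lambda>\<omega>. \<bar>f \<omega>\<bar> * \<bar>g \<omega>\<bar> * \<bar>k \<omega>\<bar>) \<le> 3 * B"
    using assms(4-6) by simp
qed

end

section \<open>Hajek projection of a weighted U-statistic\<close>

text \<open>
  One row of the array, with \<open>n\<close> large enough for tuples to exist.  The bound \<open>K\<close> on the fourth moments
  of the kernel plays the part of \<open>M(n)\<close>.
\<close>

locale weighted_ustat = indep_sample N S X n
  for N :: "'w measure" and S :: "'x measure" and X n +
  fixes m :: nat and a :: "int list \<Rightarrow> real" and h :: "'x list \<Rightarrow> real" and K :: real
  assumes m2: "m \<ge> 2" and mn: "m \<le> n"
    and h: "kernel_measurable S m h"
    and K: "K > 0"
    and moment_integrable: "\<And>js. js \<in> dtuples {1..n} m \<Longrightarrow> integrable N (\<lambda>\<omega>. obs h js \<omega> ^ 4)"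
    and moment_le: "\<And>js. js \<in> dtuples {1..n} m \<Longrightarrow> expectation (\<lambda>\<omega>. obs h js \<omega> ^ 4) \<le> K"
begin

abbreviation "T \<equiv> dtuples {1..n} m"

text \<open>
  In the following definitions, \<open>H js\<close> and \<open>D js i\<close> are the centred observation and the centred conditional
  mean given the \<open>i\<close>-th variable; \<open>Z\<close> is the centred statistic and \<open>P\<close> its Hajek projection, with the
  independent summands \<open>Y i\<close>.
\<close>

definition w :: "nat list \<Rightarrow> real" where "w js = a (map int js)"

definition c :: real where "c = fact (n - m) / fact n"

definition \<theta> :: "nat list \<Rightarrow> real" where "\<theta> js = expectation (obs h js)"

definition H :: "nat list \<Rightarrow> 'w \<Rightarrow> real" where "H js \<omega> = obs h js \<omega> - \<theta> js"

definition d :: "nat list \<Rightarrow> nat \<Rightarrow> 'x \<Rightarrow> real" where "d js i x = cond_mean h js i x - \<theta> js"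

definition D :: "nat list \<Rightarrow> nat \<Rightarrow> 'w \<Rightarrow> real" where "D js i \<omega> = d js i (X i \<omega>)"

definition Y :: "nat \<Rightarrow> 'w \<Rightarrow> real" where "Y i \<omega> = c * (\<Sum>js\<in>T. w js * D js i \<omega>)"

definition Z :: "'w \<Rightarrow> real" where "Z \<omega> = c * (\<Sum>js\<in>T. w js * H js \<omega>)"

definition P :: "'w \<Rightarrow> real" where "P \<omega> = (\<Sum>i=1..n. Y i \<omega>)"

lemma c_pos: "c > 0" by (simp add: c_def)

lemma D_notin: "js \<in> T \<Longrightarrow> i \<notin> set js \<Longrightarrow> D js i \<omega> = 0"
  by (simp add: D_def d_def \<theta>_def cond_mean_notin[OF h])

lemma d_measurable: "js \<in> T \<Longrightarrow> d js i \<in> borel_measurable S"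
  unfolding d_def by (intro borel_measurable_diff cond_mean_measurable[OF h]) auto

lemma L4_obs: "js \<in> T \<Longrightarrow> L4 (obs h js)"
  by (simp add: L4_def moment_integrable obs_measurable[OF h])

lemma L4_H: "js \<in> T \<Longrightarrow> L4 (H js)"
  unfolding H_def by (intro L4_diff L4_obs L4_const)

text \<open>
  For almost every value of the \<open>i\<close>-th variable the frozen kernel has a finite fourth moment, by Fubini's theorem
  for the kernel \<open>h\<^sup>4\<close>; there Jensen's inequality applies, and the fourth moments of the
  frozen kernels average to the one of \<open>obs h js\<close>.
\<close>

lemma cond_mean_L4:
  assumes js: "js \<in> T" and i: "i \<in> {1..n}"
  shows "L4 (\<lambda>\<omega>. cond_mean h js i (X i \<omega>))"
    and "expectation (\<lambda>\<omega>. cond_mean h js i (X i \<omega>) ^ 4) \<le> K"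
proof -
  let ?h4 = "\<lambda>xs. h xs ^ 4"
  have h4: "kernel_measurable S m ?h4" by (rule kernel_measurable_power[OF h])
  have o4: "obs ?h4 js \<omega> = obs h js \<omega> ^ 4" for \<omega> by (simp add: obs_def)
  have s4: "slice ?h4 js i x = (\<lambda>\<omega>. slice h js i x \<omega> ^ 4)" for x by (simp add: slice_def fun_eq_iff)
  have int: "integrable N (\<lambda>\<omega>. 1 * obs ?h4 js \<omega>)"
    using moment_integrable[OF js] by (simp add: o4)
  note fr = freeze_single[OF h4 js i _ int, simplified]
  have rv: "(\<lambda>\<omega>. cond_mean h js i (X i \<omega>)) \<in> borel_measurable N"
    by (rule measurable_compose[OF X_measurable[OF i] cond_mean_measurable[OF h js]])
  have jensen: "AE \<omega> in N. cond_mean h js i (X i \<omega>) ^ 4 \<le> cond_mean ?h4 js i (X i \<omega>)"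
    using fr(1) AE_space
  proof eventually_elim
    case (elim \<omega>)
    then have "X i \<omega> \<in> space S" using X_measurable[OF i] by (auto dest: measurable_space)
    then have "L4 (slice h js i (X i \<omega>))"
      using elim slice_measurable[OF h js] by (simp add: L4_def s4)
    from expectation_power4_le[OF this] show ?case
      by (simp add: cond_mean_def s4)
  qed
  have int4: "integrable N (\<lambda>\<omega>. cond_mean h js i (X i \<omega>) ^ 4)"
    by (rule Bochner_Integration.integrable_bound[OF fr(2)])
      (use jensen rv in \<open>auto elim!: eventually_mono\<close>)
  then show "L4 (\<lambda>\<omega>. cond_mean h js i (X i \<omega>))"
    using rv by (simp add: L4_def)
  have "expectation (\<lambda>\<omega>. cond_mean h js i (X i \<omega>) ^ 4) \<le> expectation (\<lambda>\<omega>. cond_mean ?h4 js i (X i \<omega>))"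
    by (rule integral_mono_AE[OF int4 fr(2) jensen])
  also have "\<dots> = expectation (obs ?h4 js)" using fr(3) by simp
  also have "\<dots> \<le> K" using moment_le[OF js] by (simp add: o4[abs_def])
  finally show "expectation (\<lambda>\<omega>. cond_mean h js i (X i \<omega>) ^ 4) \<le> K" .
qed

lemma centered_power4_le:
  assumes f: "L4 f" and le: "expectation (\<lambda>\<omega>. f \<omega> ^ 4) \<le> K" and js: "js \<in> T"
  shows "expectation (\<lambda>\<omega>. (f \<omega> - \<theta> js) ^ 4) \<le> 16 * K"
proof -
  have t: "\<theta> js ^ 4 \<le> K"
    unfolding \<theta>_def using expectation_power4_le[OF L4_obs[OF js]] moment_le[OF js] by simp
  have bd: "(f \<omega> - \<theta> js) ^ 4 \<le> 8 * (f \<omega> ^ 4 + \<theta> js ^ 4)" for \<omega>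
    using add_power4_le[of "f \<omega>" "- \<theta> js"] by simp
  have "expectation (\<lambda>\<omega>. (f \<omega> - \<theta> js) ^ 4) \<le> expectation (\<lambda>\<omega>. 8 * (f \<omega> ^ 4 + \<theta> js ^ 4))"
    using L4_integrable_power[OF L4_diff[OF f L4_const], of 4] L4_integrable_power[OF f, of 4]
    by (intro integral_mono bd) auto
  also have "\<dots> = 8 * (expectation (\<lambda>\<omega>. f \<omega> ^ 4) + \<theta> js ^ 4)"
    using L4_integrable_power[OF f, of 4] by (simp add: prob_space)
  finally show ?thesis using le t by simp
qed

lemma L4_D: "js \<in> T \<Longrightarrow> i \<in> {1..n} \<Longrightarrow> L4 (D js i)"
  unfolding D_def d_def by (intro L4_diff cond_mean_L4 L4_const)

lemma L4_Y: "i \<in> {1..n} \<Longrightarrow> L4 (Y i)"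
  unfolding Y_def by (intro L4_scale L4_sum L4_D)

lemma L4_Z: "L4 Z"
  unfolding Z_def by (intro L4_scale L4_sum L4_H)

lemma L4_P: "L4 P"
  unfolding P_def by (intro L4_sum L4_Y)

lemma H_moment:
  assumes js: "js \<in> T" and p: "p \<le> 4"
  shows "expectation (\<lambda>\<omega>. \<bar>H js \<omega>\<bar> ^ p) \<le> 17 * K powr (real p / 4)"
proof (rule abs_moment_le_of_fourth_moment[OF L4_H[OF js] _ K p])
  show "expectation (\<lambda>\<omega>. H js \<omega> ^ 4) \<le> 16 * K"
    unfolding H_def by (rule centered_power4_le[OF L4_obs[OF js] moment_le[OF js] js])
qed

lemma D_moment:
  assumes js: "js \<in> T" and i: "i \<in> {1..n}" and p: "p \<le> 4"
  shows "expectation (\<lambda>\<omega>. \<bar>D js i \<omega>\<bar> ^ p) \<le> 17 * K powr (real p / 4)"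
proof (rule abs_moment_le_of_fourth_moment[OF L4_D[OF js i] _ K p])
  show "expectation (\<lambda>\<omega>. D js i \<omega> ^ 4) \<le> 16 * K"
    unfolding D_def d_def by (rule centered_power4_le[OF cond_mean_L4[OF js i] js])
qed

lemma expectation_cond_mean:
  "js \<in> T \<Longrightarrow> i \<in> {1..n} \<Longrightarrow> expectation (\<lambda>\<omega>. cond_mean h js i (X i \<omega>)) = \<theta> js"
  using freeze_single(3)[OF h, of js i "\<lambda>_. 1"] L4_integrable[OF L4_obs, of js]
  by (simp add: \<theta>_def)

lemma expectation_D: "js \<in> T \<Longrightarrow> i \<in> {1..n} \<Longrightarrow> expectation (D js i) = 0"
  using L4_integrable[OF cond_mean_L4(1), of js i] expectation_cond_mean[of js i]
  by (simp add: D_def[abs_def] d_def prob_space)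

text \<open>
  \<open>D js i\<close> is the orthogonal projection of \<open>H js\<close> onto the centred functions of the \<open>i\<close>-th variable.
\<close>

lemma expectation_H_D:
  assumes js: "js \<in> T" and ks: "ks \<in> T" and i: "i \<in> {1..n}"
  shows "expectation (\<lambda>\<omega>. H js \<omega> * D ks i \<omega>) = expectation (\<lambda>\<omega>. D js i \<omega> * D ks i \<omega>)"
proof -
  have eq: "expectation (\<lambda>\<omega>. d ks i (X i \<omega>) * obs h js \<omega>)
      = expectation (\<lambda>\<omega>. d ks i (X i \<omega>) * cond_mean h js i (X i \<omega>))"
    by (rule freeze_single(3)[OF h js i d_measurable[OF ks]])
      (rule L4_integrable_mult[OF L4_D[OF ks i, unfolded D_def[abs_def]] L4_obs[OF js]])
  have "expectation (\<lambda>\<omega>. H js \<omega> * D ks i \<omega>)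
      = expectation (\<lambda>\<omega>. D ks i \<omega> * obs h js \<omega> - \<theta> js * D ks i \<omega>)"
    by (simp add: H_def algebra_simps)
  also have "\<dots> = expectation (\<lambda>\<omega>. D ks i \<omega> * obs h js \<omega>) - \<theta> js * expectation (D ks i)"
    using L4_integrable_mult[OF L4_D[OF ks i] L4_obs[OF js]] L4_integrable[OF L4_D[OF ks i]] by simp
  also have "expectation (\<lambda>\<omega>. D ks i \<omega> * obs h js \<omega>)
      = expectation (\<lambda>\<omega>. D ks i \<omega> * cond_mean h js i (X i \<omega>))"
    using eq by (simp add: D_def)
  also have "\<dots> - \<theta> js * expectation (D ks i)
      = expectation (\<lambda>\<omega>. D ks i \<omega> * cond_mean h js i (X i \<omega>) - \<theta> js * D ks i \<omega>)"
    using L4_integrable_mult[OF L4_D[OF ks i] cond_mean_L4(1)[OF js i]] L4_integrable[OF L4_D[OF ks i]]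
    by simp
  also have "\<dots> = expectation (\<lambda>\<omega>. D js i \<omega> * D ks i \<omega>)"
    by (simp add: D_def d_def[of js] algebra_simps)
  finally show ?thesis .
qed

text \<open>
  The heart of the variance comparison.  Choose an index \<open>i\<close> of \<open>ks\<close> such that the tuples share at most
  \<open>i\<close>.  Given the \<open>i\<close>-th variable the two observations are independent, so \<open>H js\<close> may be replaced by
  \<open>D js i\<close> and then \<open>H ks\<close> by \<open>D ks i\<close>.  In the sum on the right the terms with another index vanish;
  for disjoint tuples the term at \<open>i\<close> vanishes as well.
\<close>

lemma expectation_H_H_small_overlap:
  assumes js: "js \<in> T" and ks: "ks \<in> T" and le1: "card (set js \<inter> set ks) \<le> 1"
  shows "expectation (\<lambda>\<omega>. H js \<omega> * H ks \<omega>) = (\<Sum>i=1..n. expectation (\<lambda>\<omega>. D js i \<omega> * D ks i \<omega>))"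
proof -
  have ksn: "set ks \<subseteq> {1..n}" and "ks \<noteq> []" using ks m2 by (auto simp: dtuples_def)
  have "\<exists>i\<in>set ks. set js \<inter> set ks \<subseteq> {i}"
  proof (cases "set js \<inter> set ks = {}")
    case True
    then show ?thesis using \<open>ks \<noteq> []\<close> by (metis all_not_in_conv empty_subsetI set_empty)
  next
    case False
    then have "card (set js \<inter> set ks) = 1"
      using le1 by (metis List.finite_set One_nat_def card_gt_0_iff finite_Int le_antisym Suc_leI)
    then obtain i where "set js \<inter> set ks = {i}" by (auto simp: card_1_singleton_iff)
    then show ?thesis by blast
  qed
  then obtain i where i: "i \<in> set ks" "set js \<inter> set ks \<subseteq> {i}" by blast
  then have i_n: "i \<in> {1..n}" using ksn by blast
  have \<psi>: "(\<lambda>u. h (map u ks)) \<in> borel_measurable (Pi\<^sub>M (set ks) (\<lambda>_. S))"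
    using ks by (intro kernel_measurable_map[OF h]) (auto simp: dtuples_def intro: measurable_component_singleton)
  have \<psi>eq: "h (map (\<lambda>j\<in>set ks. X j \<omega>) ks) = obs h ks \<omega>" for \<omega>
    by (auto simp: obs_def intro!: arg_cong[of _ _ h])
  have eq: "expectation (\<lambda>\<omega>. obs h ks \<omega> * obs h js \<omega>)
      = expectation (\<lambda>\<omega>. obs h ks \<omega> * cond_mean h js i (X i \<omega>))"
    using freeze(3)[OF h js ksn i(1) _ \<psi>, unfolded \<psi>eq] i(2) L4_integrable_mult[OF L4_obs[OF ks] L4_obs[OF js]]
    by (simp add: Int_commute)
  note ints = L4_integrable_mult[OF L4_obs[OF ks] L4_obs[OF js]]
    L4_integrable_mult[OF L4_obs[OF ks] cond_mean_L4(1)[OF js i_n]]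
    L4_integrable[OF L4_obs[OF ks]] L4_integrable[OF L4_obs[OF js]]
    L4_integrable[OF cond_mean_L4(1)[OF js i_n]]
  have "expectation (\<lambda>\<omega>. H js \<omega> * H ks \<omega>) = expectation (\<lambda>\<omega>. obs h ks \<omega> * obs h js \<omega>) - \<theta> js * \<theta> ks"
    using ints by (simp add: H_def algebra_simps prob_space \<theta>_def[symmetric])
  also have "\<dots> = expectation (\<lambda>\<omega>. obs h ks \<omega> * cond_mean h js i (X i \<omega>)) - \<theta> js * \<theta> ks"
    by (simp only: eq)
  also have "\<dots> = expectation (\<lambda>\<omega>. H ks \<omega> * D js i \<omega>)"
    using ints expectation_cond_mean[OF js i_n]
    by (simp add: H_def D_def d_def algebra_simps prob_space \<theta>_def[symmetric])
  also have "\<dots> = expectation (\<lambda>\<omega>. D js i \<omega> * D ks i \<omega>)"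
    using expectation_H_D[OF ks js i_n] by (simp add: mult.commute)
  also have "\<dots> = (\<Sum>i'\<in>{i}. expectation (\<lambda>\<omega>. D js i' \<omega> * D ks i' \<omega>))" by simp
  also have "\<dots> = (\<Sum>i'=1..n. expectation (\<lambda>\<omega>. D js i' \<omega> * D ks i' \<omega>))"
  proof (rule sum.mono_neutral_left)
    show "\<forall>i'\<in>{1..n} - {i}. expectation (\<lambda>\<omega>. D js i' \<omega> * D ks i' \<omega>) = 0"
    proof
      fix i' assume "i' \<in> {1..n} - {i}"
      then have "i' \<notin> set js \<or> i' \<notin> set ks" using i by blast
      then have "(\<lambda>\<omega>. D js i' \<omega> * D ks i' \<omega>) = (\<lambda>_. 0)"
        using D_notin[OF js] D_notin[OF ks] by auto
      then show "expectation (\<lambda>\<omega>. D js i' \<omega> * D ks i' \<omega>) = 0" by simp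
    qed
  qed (use i_n in auto)
  finally show ?thesis .
qed

lemma indep_Y: "indep_vars (\<lambda>_. borel) Y {1..n}"
proof -
  have "indep_vars (\<lambda>_. borel) (\<lambda>i \<omega>. c * (\<Sum>js\<in>T. w js * d js i (X i \<omega>))) {1..n}"
    using d_measurable by (intro indep_vars_compose2[OF indep_X]) measurable
  then show ?thesis by (simp add: Y_def[abs_def] D_def)
qed

lemma expectation_Y: "i \<in> {1..n} \<Longrightarrow> expectation (Y i) = 0"
  unfolding Y_def using L4_integrable[OF L4_D] by (simp add: expectation_D)

lemma expectation_P: "expectation P = 0"
  unfolding P_def using L4_integrable[OF L4_Y] by (simp add: expectation_Y)

lemma expectation_mult_sum:
  assumes "\<And>x. x \<in> A \<Longrightarrow> L4 (f x)" "\<And>y. y \<in> B \<Longrightarrow> L4 (g y)"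
  shows "expectation (\<lambda>\<omega>. (c * (\<Sum>x\<in>A. u x * f x \<omega>)) * (c * (\<Sum>y\<in>B. v y * g y \<omega>)))
      = c\<^sup>2 * (\<Sum>x\<in>A. \<Sum>y\<in>B. u x * v y * expectation (\<lambda>\<omega>. f x \<omega> * g y \<omega>))"
proof -
  have "(c * (\<Sum>x\<in>A. u x * f x \<omega>)) * (c * (\<Sum>y\<in>B. v y * g y \<omega>))
      = c\<^sup>2 * (\<Sum>x\<in>A. \<Sum>y\<in>B. u x * v y * (f x \<omega> * g y \<omega>))" for \<omega>
  proof -
    have "(c * (\<Sum>x\<in>A. u x * f x \<omega>)) * (c * (\<Sum>y\<in>B. v y * g y \<omega>))
      = c\<^sup>2 * ((\<Sum>x\<in>A. u x * f x \<omega>) * (\<Sum>y\<in>B. v y * g y \<omega>))"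
      by (simp add: power2_eq_square)
    then show ?thesis by (simp add: sum_product ac_simps)
  qed
  then show ?thesis
    using L4_integrable_mult[OF assms] by (simp add: Bochner_Integration.integral_sum)
qed

lemma expectation_Y_square:
  "i \<in> {1..n} \<Longrightarrow> expectation (\<lambda>\<omega>. (Y i \<omega>)\<^sup>2)
     = c\<^sup>2 * (\<Sum>js\<in>T. \<Sum>ks\<in>T. w js * w ks * expectation (\<lambda>\<omega>. D js i \<omega> * D ks i \<omega>))"
  unfolding Y_def power2_eq_square[of "_ * _"] by (rule expectation_mult_sum) (auto intro: L4_D)

lemma expectation_Z_square:
  "expectation (\<lambda>\<omega>. (Z \<omega>)\<^sup>2)
     = c\<^sup>2 * (\<Sum>js\<in>T. \<Sum>ks\<in>T. w js * w ks * expectation (\<lambda>\<omega>. H js \<omega> * H ks \<omega>))"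
  unfolding Z_def power2_eq_square[of "_ * _"] by (rule expectation_mult_sum) (auto intro: L4_H)

lemma expectation_Z_Y:
  assumes i: "i \<in> {1..n}"
  shows "expectation (\<lambda>\<omega>. Z \<omega> * Y i \<omega>) = expectation (\<lambda>\<omega>. (Y i \<omega>)\<^sup>2)"
proof -
  have "expectation (\<lambda>\<omega>. Z \<omega> * Y i \<omega>)
      = c\<^sup>2 * (\<Sum>js\<in>T. \<Sum>ks\<in>T. w js * w ks * expectation (\<lambda>\<omega>. H js \<omega> * D ks i \<omega>))"
    unfolding Z_def Y_def by (rule expectation_mult_sum) (auto intro: L4_H L4_D i)
  also have "\<dots> = c\<^sup>2 * (\<Sum>js\<in>T. \<Sum>ks\<in>T. w js * w ks * expectation (\<lambda>\<omega>. D js i \<omega> * D ks i \<omega>))"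
    by (intro arg_cong2[of _ _ _ _ "(*)"] refl sum.cong expectation_H_D i)
  finally show ?thesis by (simp only: expectation_Y_square[OF i])
qed

lemma expectation_P_square: "expectation (\<lambda>\<omega>. (P \<omega>)\<^sup>2) = (\<Sum>i=1..n. expectation (\<lambda>\<omega>. (Y i \<omega>)\<^sup>2))"
proof -
  (* Independence and zero means make the summands orthogonal. *)
  have ortho: "expectation (\<lambda>\<omega>. Y i \<omega> * Y k \<omega>) = 0" if "i \<in> {1..n}" "k \<in> {1..n}" "i \<noteq> k" for i k
  proof -
    have "expectation (\<lambda>\<omega>. \<Prod>j\<in>{i, k}. Y j \<omega>) = (\<Prod>j\<in>{i, k}. expectation (Y j))"
    proof (rule indep_vars_lebesgue_integral)
      show "indep_vars (\<lambda>_. borel) Y {i, k}"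
        using that by (intro indep_vars_subset[OF indep_Y]) auto
      show "integrable N (Y j)" if "j \<in> {i, k}" for j
        using that \<open>i \<in> {1..n}\<close> \<open>k \<in> {1..n}\<close> by (intro L4_integrable L4_Y) auto
    qed simp
    then show ?thesis using that expectation_Y[OF that(1)] by simp
  qed
  have "expectation (\<lambda>\<omega>. (P \<omega>)\<^sup>2) = (\<Sum>i=1..n. \<Sum>k=1..n. expectation (\<lambda>\<omega>. Y i \<omega> * Y k \<omega>))"
    unfolding P_def power2_eq_square sum_product
    by (subst Bochner_Integration.integral_sum,
        (intro Bochner_Integration.integrable_sum L4_integrable_mult L4_Y; assumption),
        intro sum.cong refl Bochner_Integration.integral_sum L4_integrable_mult L4_Y)
  also have "\<dots> = (\<Sum>i=1..n. \<Sum>k=1..n. if k = i then expectation (\<lambda>\<omega>. (Y i \<omega>)\<^sup>2) else 0)"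
    by (intro sum.cong refl) (auto simp: ortho power2_eq_square)
  finally show ?thesis by simp
qed

text \<open>
  \<open>P\<close> is the orthogonal projection of \<open>Z\<close> onto the sums of functions of single variables.
\<close>

lemma expectation_Z_P: "expectation (\<lambda>\<omega>. Z \<omega> * P \<omega>) = expectation (\<lambda>\<omega>. (P \<omega>)\<^sup>2)"
proof -
  have "expectation (\<lambda>\<omega>. Z \<omega> * P \<omega>) = (\<Sum>i=1..n. expectation (\<lambda>\<omega>. Z \<omega> * Y i \<omega>))"
    unfolding P_def sum_distrib_left using L4_integrable_mult[OF L4_Z L4_Y] by simp
  then show ?thesis by (simp add: expectation_Z_Y expectation_P_square)
qed

section \<open>Bounds by the average weights\<close>

lemma expectation_H_square_le: "js \<in> T \<Longrightarrow> expectation (\<lambda>\<omega>. (H js \<omega>)\<^sup>2) \<le> 17 * K powr (1 / 2)"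
  using H_moment[of js 2] by simp

lemma expectation_D_square_le:
  "js \<in> T \<Longrightarrow> i \<in> {1..n} \<Longrightarrow> expectation (\<lambda>\<omega>. (D js i \<omega>)\<^sup>2) \<le> 17 * K powr (1 / 2)"
  using D_moment[of js i 2] by simp

text \<open>
  A pair with large overlap contributes one covariance of the \<open>H\<close> and at most \<open>m\<close> nonzero ones of the \<open>D\<close>.
\<close>

lemma covariance_defect_le:
  assumes js: "js \<in> T" and ks: "ks \<in> T"
  shows "\<bar>expectation (\<lambda>\<omega>. H js \<omega> * H ks \<omega>) - (\<Sum>i=1..n. expectation (\<lambda>\<omega>. D js i \<omega> * D ks i \<omega>))\<bar>
     \<le> (if 2 \<le> card (set js \<inter> set ks) then (real m + 1) * (17 * K powr (1 / 2)) else 0)"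
proof (cases "2 \<le> card (set js \<inter> set ks)")
  case False
  then show ?thesis using expectation_H_H_small_overlap[OF js ks] by simp
next
  case True
  define B where "B = 17 * K powr (1 / 2)"
  have sub: "set js \<subseteq> {1..n}" and card: "card (set js) = m"
    using js by (auto simp: dtuples_def distinct_card)
  have HH: "\<bar>expectation (\<lambda>\<omega>. H js \<omega> * H ks \<omega>)\<bar> \<le> B"
    unfolding B_def by (intro abs_expectation_mult_le L4_H expectation_H_square_le js ks)
  have "(\<Sum>i=1..n. expectation (\<lambda>\<omega>. D js i \<omega> * D ks i \<omega>))
      = (\<Sum>i\<in>set js. expectation (\<lambda>\<omega>. D js i \<omega> * D ks i \<omega>))"
    using sub by (intro sum.mono_neutral_right) (auto simp: D_notin[OF js])
  also have "\<bar>\<dots>\<bar> \<le> (\<Sum>i\<in>set js. B)"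
  proof (rule order_trans[OF sum_abs sum_mono])
    fix i assume "i \<in> set js"
    then have i: "i \<in> {1..n}" using sub by blast
    show "\<bar>expectation (\<lambda>\<omega>. D js i \<omega> * D ks i \<omega>)\<bar> \<le> B"
      unfolding B_def by (intro abs_expectation_mult_le L4_D expectation_D_square_le js ks i)
  qed
  also have "\<dots> = real m * B" by (simp add: card)
  finally show ?thesis using HH True by (simp add: B_def algebra_simps)
qed

text \<open>
  Only the pairs counted by \<open>A\<^sub>2\<^sub>,\<^sub>2\<close> survive in the difference of the two double sums.
\<close>

lemma variance_gap_le:
  "\<bar>expectation (\<lambda>\<omega>. (Z \<omega>)\<^sup>2) - expectation (\<lambda>\<omega>. (P \<omega>)\<^sup>2)\<bar>
     \<le> 17 * (real m + 1) * real m ^ (2 * m + 4) * (1 / real n ^ 2 * avg_weight a m 2 2 n * K powr (1 / 2))"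
proof -
  define E1 where "E1 js ks = expectation (\<lambda>\<omega>. H js \<omega> * H ks \<omega>)" for js ks
  define E2 where "E2 js ks = (\<Sum>i=1..n. expectation (\<lambda>\<omega>. D js i \<omega> * D ks i \<omega>))" for js ks
  define B where "B = (real m + 1) * (17 * K powr (1 / 2))"
  have B0: "B \<ge> 0" by (simp add: B_def)
  have P2: "expectation (\<lambda>\<omega>. (P \<omega>)\<^sup>2) = c\<^sup>2 * (\<Sum>js\<in>T. \<Sum>ks\<in>T. w js * w ks * E2 js ks)"
  proof -
    have "expectation (\<lambda>\<omega>. (P \<omega>)\<^sup>2)
        = c\<^sup>2 * (\<Sum>i=1..n. \<Sum>js\<in>T. \<Sum>ks\<in>T. w js * w ks * expectation (\<lambda>\<omega>. D js i \<omega> * D ks i \<omega>))"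
      unfolding expectation_P_square sum_distrib_left[of "c\<^sup>2" _ "{1..n}"]
      by (intro sum.cong refl expectation_Y_square)
    also have "(\<Sum>i=1..n. \<Sum>js\<in>T. \<Sum>ks\<in>T. w js * w ks * expectation (\<lambda>\<omega>. D js i \<omega> * D ks i \<omega>))
        = (\<Sum>js\<in>T. \<Sum>ks\<in>T. \<Sum>i=1..n. w js * w ks * expectation (\<lambda>\<omega>. D js i \<omega> * D ks i \<omega>))"
      by (subst sum.swap, rule sum.cong[OF refl], rule sum.swap)
    finally show ?thesis by (simp only: E2_def sum_distrib_left)
  qed
  have "expectation (\<lambda>\<omega>. (Z \<omega>)\<^sup>2) - expectation (\<lambda>\<omega>. (P \<omega>)\<^sup>2)
      = c\<^sup>2 * (\<Sum>js\<in>T. \<Sum>ks\<in>T. w js * w ks * (E1 js ks - E2 js ks))"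
    unfolding P2 expectation_Z_square E1_def[symmetric]
    by (simp add: right_diff_distrib sum_subtractf)
  also have "\<bar>\<dots>\<bar> = c\<^sup>2 * \<bar>\<Sum>js\<in>T. \<Sum>ks\<in>T. w js * w ks * (E1 js ks - E2 js ks)\<bar>"
    by (simp add: abs_mult)
  also have "\<dots> \<le> c\<^sup>2 * (\<Sum>js\<in>T. \<Sum>ks\<in>T. if 2 \<le> card (set js \<inter> set ks) then \<bar>w js * w ks\<bar> * B else 0)"
  proof (rule mult_left_mono)
    have "\<bar>\<Sum>js\<in>T. \<Sum>ks\<in>T. w js * w ks * (E1 js ks - E2 js ks)\<bar>
        \<le> (\<Sum>js\<in>T. \<Sum>ks\<in>T. \<bar>w js * w ks * (E1 js ks - E2 js ks)\<bar>)"
      by (rule order_trans[OF sum_abs sum_mono[OF sum_abs]])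
    also have "\<dots> \<le> (\<Sum>js\<in>T. \<Sum>ks\<in>T. if 2 \<le> card (set js \<inter> set ks) then \<bar>w js * w ks\<bar> * B else 0)"
    proof (intro sum_mono)
      fix js ks assume "js \<in> T" "ks \<in> T"
      from covariance_defect_le[OF this]
      have "\<bar>E1 js ks - E2 js ks\<bar> \<le> (if 2 \<le> card (set js \<inter> set ks) then B else 0)"
        by (simp only: E1_def E2_def B_def)
      then have "\<bar>w js * w ks\<bar> * \<bar>E1 js ks - E2 js ks\<bar>
          \<le> \<bar>w js * w ks\<bar> * (if 2 \<le> card (set js \<inter> set ks) then B else 0)"
        by (rule mult_left_mono) simp
      then show "\<bar>w js * w ks * (E1 js ks - E2 js ks)\<bar>
          \<le> (if 2 \<le> card (set js \<inter> set ks) then \<bar>w js * w ks\<bar> * B else 0)"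
        by (simp add: abs_mult split: if_splits)
    qed
    finally show "\<bar>\<Sum>js\<in>T. \<Sum>ks\<in>T. w js * w ks * (E1 js ks - E2 js ks)\<bar>
        \<le> (\<Sum>js\<in>T. \<Sum>ks\<in>T. if 2 \<le> card (set js \<inter> set ks) then \<bar>w js * w ks\<bar> * B else 0)" .
  qed simp
  also have "(\<Sum>js\<in>T. \<Sum>ks\<in>T. if 2 \<le> card (set js \<inter> set ks) then \<bar>w js * w ks\<bar> * B else 0)
      = (\<Sum>jss\<in>overlap_tuples n m 2 2. \<bar>w (jss ! 0) * w (jss ! 1)\<bar> * B)"
    by (rule sum_overlap_pairs)
  also have "\<dots> = (\<Sum>jss\<in>overlap_tuples n m 2 2. \<bar>\<Prod>js\<leftarrow>jss. a (map int js)\<bar> * B)"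
  proof (rule sum.cong[OF refl])
    fix jss assume "jss \<in> overlap_tuples n m 2 2"
    then obtain js ks where "jss = [js, ks]"
      by (auto simp: overlap_tuples_def length_Suc_conv numeral_2_eq_2)
    then show "\<bar>w (jss ! 0) * w (jss ! 1)\<bar> * B = \<bar>\<Prod>js\<leftarrow>jss. a (map int js)\<bar> * B"
      by (simp add: w_def)
  qed
  also have "\<dots> = B * (real (card (overlap_tuples n m 2 2)) * avg_weight a m 2 2 n)"
    unfolding sum_distrib_right[symmetric] sum_overlap_weights by (rule mult.commute)
  also have "c\<^sup>2 * \<dots> = (c\<^sup>2 * real (card (overlap_tuples n m 2 2))) * (B * avg_weight a m 2 2 n)"
    by (simp add: ac_simps)
  also have "\<dots> \<le> (real m ^ (2 * m + 4) / real n ^ 2) * (B * avg_weight a m 2 2 n)"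
    unfolding c_def
    by (intro mult_right_mono normalized_overlap_count_22 mult_nonneg_nonneg B0 avg_weight_nonneg m2 mn)
  also have "\<dots> = 17 * (real m + 1) * real m ^ (2 * m + 4) * (1 / real n ^ 2 * avg_weight a m 2 2 n * K powr (1 / 2))"
    by (simp add: B_def)
  finally show ?thesis .
qed

text \<open>
  The cube of \<open>Y i\<close> is a sum over triples of tuples, in which only triples that all contain \<open>i\<close> are nonzero.
  After exchanging the sums, a triple is met once for each of its at most \<open>m\<close> common indices, and
  the triples met at all are those counted by \<open>A\<^sub>3\<^sub>,\<^sub>1\<close>.
\<close>

lemma sum_third_moment_le:
  "(\<Sum>i=1..n. expectation (\<lambda>\<omega>. \<bar>Y i \<omega>\<bar> ^ 3))
     \<le> 51 * real m ^ (3 * m + 4) * (1 / real n ^ 2 * avg_weight a m 3 1 n * K powr (3 / 4))"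
proof -
  define B where "B = 3 * (17 * K powr (3 / 4))"
  define E where "E i js ks ls = expectation (\<lambda>\<omega>. \<bar>D js i \<omega>\<bar> * \<bar>D ks i \<omega>\<bar> * \<bar>D ls i \<omega>\<bar>)" for i js ks ls
  define W where "W js ks ls = \<bar>w js\<bar> * \<bar>w ks\<bar> * \<bar>w ls\<bar>" for js ks ls
  have B0: "B \<ge> 0" by (simp add: B_def)
  have D3: "expectation (\<lambda>\<omega>. \<bar>D js i \<omega>\<bar> ^ 3) \<le> 17 * K powr (3 / 4)" if "js \<in> T" "i \<in> {1..n}" for js i
    using D_moment[OF that, of 3] by simp
  have Eint: "integrable N (\<lambda>\<omega>. \<bar>D js i \<omega>\<bar> * \<bar>D ks i \<omega>\<bar> * \<bar>D ls i \<omega>\<bar>)"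
    and EB: "E i js ks ls \<le> B"
    if "js \<in> T" "ks \<in> T" "ls \<in> T" "i \<in> {1..n}" for i js ks ls
    using expectation_abs_mult3_le[OF L4_D L4_D L4_D D3 D3 D3, of js i ks i ls i] that
    by (simp_all add: E_def B_def)
  have Y3: "expectation (\<lambda>\<omega>. \<bar>Y i \<omega>\<bar> ^ 3) \<le> c ^ 3 * (\<Sum>js\<in>T. \<Sum>ks\<in>T. \<Sum>ls\<in>T. W js ks ls * E i js ks ls)"
    if i: "i \<in> {1..n}" for i
  proof -
    have bd: "\<bar>Y i \<omega>\<bar> ^ 3 \<le> c ^ 3 * (\<Sum>js\<in>T. \<Sum>ks\<in>T. \<Sum>ls\<in>T. W js ks ls * (\<bar>D js i \<omega>\<bar> * \<bar>D ks i \<omega>\<bar> * \<bar>D ls i \<omega>\<bar>))"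
      for \<omega>
    proof -
      let ?S = "\<Sum>js\<in>T. \<bar>w js\<bar> * \<bar>D js i \<omega>\<bar>"
      have "\<bar>Y i \<omega>\<bar> = c * \<bar>\<Sum>js\<in>T. w js * D js i \<omega>\<bar>"
        using c_pos by (simp add: Y_def abs_mult)
      also have "\<dots> \<le> c * (\<Sum>js\<in>T. \<bar>w js * D js i \<omega>\<bar>)"
        using c_pos by (intro mult_left_mono sum_abs) auto
      finally have "\<bar>Y i \<omega>\<bar> ^ 3 \<le> (c * ?S) ^ 3"
        by (intro power_mono) (simp_all add: abs_mult)
      also have "\<dots> = c ^ 3 * (?S * (?S * ?S))"
        by (simp add: power_mult_distrib power3_eq_cube mult.assoc)
      also have "?S * (?S * ?S) = (\<Sum>js\<in>T. \<Sum>ks\<in>T. \<Sum>ls\<in>T. (\<bar>w js\<bar> * \<bar>D js i \<omega>\<bar>) * ((\<bar>w ks\<bar> * \<bar>D ks i \<omega>\<bar>) * (\<bar>w ls\<bar> * \<bar>D ls i \<omega>\<bar>)))"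
        by (simp only: sum_product) (simp only: sum_distrib_left)
      finally show ?thesis by (simp add: W_def ac_simps)
    qed
    have "expectation (\<lambda>\<omega>. \<bar>Y i \<omega>\<bar> ^ 3) \<le> expectation (\<lambda>\<omega>. c ^ 3 * (\<Sum>js\<in>T. \<Sum>ks\<in>T. \<Sum>ls\<in>T. W js ks ls * (\<bar>D js i \<omega>\<bar> * \<bar>D ks i \<omega>\<bar> * \<bar>D ls i \<omega>\<bar>)))"
      using L4_integrable_abs_power[OF L4_Y[OF i], of 3] Eint[OF _ _ _ i]
      by (intro integral_mono bd) auto
    also have "\<dots> = c ^ 3 * (\<Sum>js\<in>T. \<Sum>ks\<in>T. \<Sum>ls\<in>T. W js ks ls * E i js ks ls)"
      using Eint[OF _ _ _ i] by (simp add: E_def)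
    finally show ?thesis .
  qed
  (* Only common indices of the three tuples contribute, and each contributes at most B. *)
  have sumE: "(\<Sum>i=1..n. E i js ks ls) \<le> (if 1 \<le> card (set js \<inter> set ks \<inter> set ls) then real m * B else 0)"
    if js: "js \<in> T" and ks: "ks \<in> T" and ls: "ls \<in> T" for js ks ls
  proof -
    let ?I = "set js \<inter> set ks \<inter> set ls"
    have sub: "?I \<subseteq> {1..n}" and cm: "card ?I \<le> m"
    proof -
      show "?I \<subseteq> {1..n}" using js by (auto simp: dtuples_def)
      have "card ?I \<le> card (set js)" by (intro card_mono) auto
      then show "card ?I \<le> m" using js by (auto simp: dtuples_def distinct_card)
    qed
    have "(\<Sum>i=1..n. E i js ks ls) = (\<Sum>i\<in>?I. E i js ks ls)"
    proof (rule sum.mono_neutral_right[OF _ sub])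
      show "\<forall>i\<in>{1..n} - ?I. E i js ks ls = 0"
      proof
        fix i assume "i \<in> {1..n} - ?I"
        then have "(\<lambda>\<omega>. \<bar>D js i \<omega>\<bar> * \<bar>D ks i \<omega>\<bar> * \<bar>D ls i \<omega>\<bar>) = (\<lambda>_. 0)"
          using D_notin[OF js] D_notin[OF ks] D_notin[OF ls] by auto
        then show "E i js ks ls = 0" by (simp add: E_def)
      qed
    qed simp
    also have "\<dots> \<le> (\<Sum>i\<in>?I. B)"
      using sub by (intro sum_mono EB js ks ls) auto
    also have "\<dots> = real (card ?I) * B" by simp
    also have "\<dots> \<le> (if 1 \<le> card ?I then real m * B else 0)"
      using cm B0 by (auto intro!: mult_right_mono simp: Suc_le_eq simp del: card_eq_0_iff)
    finally show ?thesis .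
  qed
  have "(\<Sum>i=1..n. expectation (\<lambda>\<omega>. \<bar>Y i \<omega>\<bar> ^ 3))
      \<le> (\<Sum>i=1..n. c ^ 3 * (\<Sum>js\<in>T. \<Sum>ks\<in>T. \<Sum>ls\<in>T. W js ks ls * E i js ks ls))"
    by (intro sum_mono Y3)
  also have "\<dots> = c ^ 3 * (\<Sum>i=1..n. \<Sum>js\<in>T. \<Sum>ks\<in>T. \<Sum>ls\<in>T. W js ks ls * E i js ks ls)"
    by (simp only: sum_distrib_left)
  also have "(\<Sum>i=1..n. \<Sum>js\<in>T. \<Sum>ks\<in>T. \<Sum>ls\<in>T. W js ks ls * E i js ks ls)
      = (\<Sum>js\<in>T. \<Sum>ks\<in>T. \<Sum>ls\<in>T. \<Sum>i=1..n. W js ks ls * E i js ks ls)"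
    by (subst sum.swap, rule sum.cong[OF refl], subst sum.swap, rule sum.cong[OF refl], rule sum.swap)
  also have "\<dots> = (\<Sum>js\<in>T. \<Sum>ks\<in>T. \<Sum>ls\<in>T. W js ks ls * (\<Sum>i=1..n. E i js ks ls))"
    by (simp only: sum_distrib_left)
  also have "c ^ 3 * \<dots> \<le> c ^ 3 * (\<Sum>js\<in>T. \<Sum>ks\<in>T. \<Sum>ls\<in>T.
      if 1 \<le> card (set js \<inter> set ks \<inter> set ls) then W js ks ls * (real m * B) else 0)"
  proof (intro mult_left_mono sum_mono)
    fix js ks ls assume "js \<in> T" "ks \<in> T" "ls \<in> T"
    then have "W js ks ls * (\<Sum>i=1..n. E i js ks ls)
        \<le> W js ks ls * (if 1 \<le> card (set js \<inter> set ks \<inter> set ls) then real m * B else 0)"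
      by (intro mult_left_mono sumE) (auto simp: W_def)
    then show "W js ks ls * (\<Sum>i=1..n. E i js ks ls)
        \<le> (if 1 \<le> card (set js \<inter> set ks \<inter> set ls) then W js ks ls * (real m * B) else 0)"
      by (simp split: if_splits)
  qed (use c_pos in simp)
  also have "(\<Sum>js\<in>T. \<Sum>ks\<in>T. \<Sum>ls\<in>T.
      if 1 \<le> card (set js \<inter> set ks \<inter> set ls) then W js ks ls * (real m * B) else 0)
      = (\<Sum>jss\<in>overlap_tuples n m 3 1. W (jss ! 0) (jss ! 1) (jss ! 2) * (real m * B))"
    by (rule sum_overlap_triples)
  also have "\<dots> = (\<Sum>jss\<in>overlap_tuples n m 3 1. \<bar>\<Prod>js\<leftarrow>jss. a (map int js)\<bar> * (real m * B))"
  proof (rule sum.cong[OF refl])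
    fix jss assume "jss \<in> overlap_tuples n m 3 1"
    then obtain js ks ls where "jss = [js, ks, ls]"
      by (auto simp: overlap_tuples_def length_Suc_conv numeral_3_eq_3)
    then show "W (jss ! 0) (jss ! 1) (jss ! 2) * (real m * B) = \<bar>\<Prod>js\<leftarrow>jss. a (map int js)\<bar> * (real m * B)"
      by (simp add: W_def w_def abs_mult)
  qed
  also have "\<dots> = (real m * B) * (real (card (overlap_tuples n m 3 1)) * avg_weight a m 3 1 n)"
    unfolding sum_distrib_right[symmetric] sum_overlap_weights by (rule mult.commute)
  also have "c ^ 3 * \<dots> = (c ^ 3 * real (card (overlap_tuples n m 3 1))) * (real m * B * avg_weight a m 3 1 n)"
    by (simp add: ac_simps)
  also have "\<dots> \<le> (real m ^ (3 * m + 3) / real n ^ 2) * (real m * B * avg_weight a m 3 1 n)"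
    unfolding c_def using m2
    by (intro mult_right_mono normalized_overlap_count_31 mult_nonneg_nonneg B0 avg_weight_nonneg mn) auto
  also have "\<dots> = 51 * real m ^ (3 * m + 4) * (1 / real n ^ 2 * avg_weight a m 3 1 n * K powr (3 / 4))"
  proof -
    have "real m ^ (3 * m + 4) = real m ^ (3 * m + 3) * real m" by (simp add: power_add numeral_eq_Suc)
    then show ?thesis by (simp add: B_def)
  qed
  finally show ?thesis .
qed

end

section \<open>The statistic of a single row\<close>

lemma (in indep_sample) ustat_measurable:
  assumes "kernel_measurable S m h"
  shows "ustat X a h m n \<in> borel_measurable N"
proof -
  have "ustat X a h m n = (\<lambda>\<omega>. fact (n - m) / fact n * (\<Sum>js\<in>dtuples {1..n} m. a (map int js) * obs h js \<omega>))"
    by (simp add: ustat_def obs_def fun_eq_iff)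
  then show ?thesis
    using obs_measurable[OF assms] by simp
qed

context weighted_ustat
begin

lemma kernel_mean_eq: "kernel_mean N X h js = \<theta> js"
  by (simp add: kernel_mean_def \<theta>_def obs_def[abs_def])

lemma ustat_centered: "ustat X a h m n \<omega> - expectation (ustat X a h m n) = Z \<omega>"
proof -
  have u: "ustat X a h m n = (\<lambda>\<omega>. c * (\<Sum>js\<in>T. w js * obs h js \<omega>))"
    by (simp add: ustat_def obs_def fun_eq_iff c_def w_def)
  have "expectation (ustat X a h m n) = c * (\<Sum>js\<in>T. w js * \<theta> js)"
    unfolding u \<theta>_def using L4_integrable[OF L4_obs] by simp
  then show ?thesis
    by (simp add: u Z_def H_def right_diff_distrib sum_subtractf)
qed

lemma variance_ustat: "variance (ustat X a h m n) = expectation (\<lambda>\<omega>. (Z \<omega>)\<^sup>2)"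
  by (simp only: ustat_centered)

text \<open>
  Tuples that do not contain \<open>i\<close> may be added to the sum because their \<open>D js i\<close> is zero.
\<close>

lemma hproj_eq_Y:
  assumes i: "i \<in> {1..n}" and \<omega>: "\<omega> \<in> space N"
  shows "1 / real n * hproj N S X a h m n i (X i \<omega>) = Y i \<omega>"
proof -
  define x where "x = X i \<omega>"
  have x: "x \<in> space S" unfolding x_def by (rule measurable_space[OF X_measurable[OF i] \<omega>])
  have "(\<Sum>js\<in>dtuples ({1..n} - {i}) (m - 1). \<Sum>l=1..m.
          a (map int (tuple_insert l i js)) *
            (kernel_proj N S X h l js x - kernel_mean N X h (tuple_insert l i js)))
      = (\<Sum>js\<in>dtuples ({1..n} - {i}) (m - 1). \<Sum>l=1..m. w (tuple_insert l i js) * d (tuple_insert l i js) i x)"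
    by (intro sum.cong refl)
      (simp only: w_def d_def kernel_mean_eq kernel_proj_eq_cond_mean[OF h m2 _ x])
  also have "\<dots> = (\<Sum>z\<in>dtuples ({1..n} - {i}) (m - 1) \<times> {1..m}.
      (\<lambda>ks. w ks * d ks i x) ((\<lambda>(js, l). tuple_insert l i js) z))"
    by (simp add: sum.cartesian_product case_prod_beta)
  also have "\<dots> = (\<Sum>ks\<in>{ks \<in> T. i \<in> set ks}. w ks * d ks i x)"
    using m2 i by (intro sum.reindex_bij_betw bij_betw_tuple_insert) auto
  also have "\<dots> = (\<Sum>ks\<in>T. w ks * d ks i x)"
    using D_notin[of _ i \<omega>] by (intro sum.mono_neutral_left) (auto simp: D_def x_def)
  finally have "hproj N S X a h m n i x = fact (n - m) / fact (n - 1) * (\<Sum>ks\<in>T. w ks * d ks i x)"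
    by (simp only: hproj_def)
  moreover have "1 / real n * (fact (n - m) / fact (n - 1)) = c"
    using m2 mn by (simp add: c_def fact_reduce[of n])
  ultimately show ?thesis
    by (simp only: Y_def D_def x_def mult.assoc[symmetric])
qed

lemma variance_hproj:
  "variance (\<lambda>\<omega>. 1 / real n * (\<Sum>i=1..n. hproj N S X a h m n i (X i \<omega>))) = expectation (\<lambda>\<omega>. (P \<omega>)\<^sup>2)"
proof -
  have eq: "1 / real n * (\<Sum>i=1..n. hproj N S X a h m n i (X i \<omega>)) = P \<omega>" if "\<omega> \<in> space N" for \<omega>
    unfolding P_def sum_distrib_left using that by (intro sum.cong refl hproj_eq_Y)
  have "expectation (\<lambda>\<omega>. 1 / real n * (\<Sum>i=1..n. hproj N S X a h m n i (X i \<omega>))) = expectation P"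
    by (intro Bochner_Integration.integral_cong refl eq)
  then have "expectation (\<lambda>\<omega>. 1 / real n * (\<Sum>i=1..n. hproj N S X a h m n i (X i \<omega>))) = 0"
    by (simp only: expectation_P)
  then show ?thesis
    by (intro Bochner_Integration.integral_cong refl) (simp only: eq diff_zero)
qed

text \<open>
  Both are consequences of \<open>E (Z * P) = E P\<^sup>2\<close>.
\<close>

lemma expectation_remainder_square:
  "expectation (\<lambda>\<omega>. (Z \<omega> - P \<omega>)\<^sup>2) = expectation (\<lambda>\<omega>. (Z \<omega>)\<^sup>2) - expectation (\<lambda>\<omega>. (P \<omega>)\<^sup>2)"
  and expectation_scaled_remainder_square:
  "expectation (\<lambda>\<omega>. (u * Z \<omega> - v * P \<omega>)\<^sup>2)
     = u\<^sup>2 * expectation (\<lambda>\<omega>. (Z \<omega>)\<^sup>2) + (v\<^sup>2 - 2 * u * v) * expectation (\<lambda>\<omega>. (P \<omega>)\<^sup>2)"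
proof -
  note ints = L4_integrable_power[OF L4_Z, of 2, simplified] L4_integrable_power[OF L4_P, of 2, simplified]
    L4_integrable_mult[OF L4_Z L4_P]
  show *: "expectation (\<lambda>\<omega>. (u * Z \<omega> - v * P \<omega>)\<^sup>2)
     = u\<^sup>2 * expectation (\<lambda>\<omega>. (Z \<omega>)\<^sup>2) + (v\<^sup>2 - 2 * u * v) * expectation (\<lambda>\<omega>. (P \<omega>)\<^sup>2)" for u v
  proof -
    have "(u * Z \<omega> - v * P \<omega>)\<^sup>2 = u\<^sup>2 * (Z \<omega>)\<^sup>2 + v\<^sup>2 * (P \<omega>)\<^sup>2 - 2 * u * v * (Z \<omega> * P \<omega>)" for \<omega>
      by algebra
    then have "expectation (\<lambda>\<omega>. (u * Z \<omega> - v * P \<omega>)\<^sup>2)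
        = expectation (\<lambda>\<omega>. u\<^sup>2 * (Z \<omega>)\<^sup>2 + v\<^sup>2 * (P \<omega>)\<^sup>2 - 2 * u * v * (Z \<omega> * P \<omega>))"
      by (simp only:)
    also have "\<dots> = u\<^sup>2 * expectation (\<lambda>\<omega>. (Z \<omega>)\<^sup>2) + v\<^sup>2 * expectation (\<lambda>\<omega>. (P \<omega>)\<^sup>2)
        - 2 * u * v * expectation (\<lambda>\<omega>. Z \<omega> * P \<omega>)"
      using ints by simp
    finally show ?thesis by (simp add: expectation_Z_P left_diff_distrib)
  qed
  from *[of 1 1] show "expectation (\<lambda>\<omega>. (Z \<omega> - P \<omega>)\<^sup>2)
      = expectation (\<lambda>\<omega>. (Z \<omega>)\<^sup>2) - expectation (\<lambda>\<omega>. (P \<omega>)\<^sup>2)" by simp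
qed

text \<open>
  With \<open>u = s\<^bsup>-1/2\<^esup>\<close> and \<open>r = V\<^bsup>-1/2\<^esup>\<close> the variables \<open>u Z\<close> and \<open>r P\<close> have variance 1 and covariance
  \<open>u r V = sqrt (V / s)\<close>, which gives their \<open>L\<^sup>2\<close>-distance.  The normal approximation of \<open>r P\<close> is
  \<open>char_sum_normal_bound\<close>.  Positivity of \<open>s\<close> comes from \<open>V \<le> s\<close>.
\<close>

lemma char_normalized_bound:
  defines "V \<equiv> expectation (\<lambda>\<omega>. (P \<omega>)\<^sup>2)" and "s \<equiv> expectation (\<lambda>\<omega>. (Z \<omega>)\<^sup>2)"
  assumes V: "V > 0"
  shows "cmod (char (distr N borel (\<lambda>\<omega>. s powr (-1/2) * Z \<omega>)) t - exp (- (t\<^sup>2) / 2))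
     \<le> \<bar>t\<bar> * sqrt (2 * (1 - sqrt (V / s)))
       + (\<bar>t\<bar> ^ 3 / 6 + t ^ 4 / 8) * (V powr (-3/2) * (\<Sum>i=1..n. expectation (\<lambda>\<omega>. \<bar>Y i \<omega>\<bar> ^ 3)))"
proof -
  define r where "r = V powr (-1/2)"
  define u where "u = s powr (-1/2)"
  have "0 \<le> expectation (\<lambda>\<omega>. (Z \<omega> - P \<omega>)\<^sup>2)" by simp
  then have s: "s > 0" using V by (simp add: expectation_remainder_square V_def s_def)
  have r: "r = 1 / sqrt V" and u: "u = 1 / sqrt s"
    using V s powr_minus[of V "1/2"] powr_minus[of s "1/2"]
    by (simp_all add: r_def u_def powr_half_sqrt inverse_eq_divide)
  have r3: "V powr (-3/2) = r ^ 3"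
    using powr_powr[of V "-1/2" 3] by (simp add: r_def)
  have r0: "r \<ge> 0" by (simp add: r_def)
  have "cmod (char (distr N borel (\<lambda>\<omega>. u * Z \<omega>)) t - char (distr N borel (\<lambda>\<omega>. r * P \<omega>)) t)
      \<le> \<bar>t\<bar> * sqrt (expectation (\<lambda>\<omega>. (u * Z \<omega> - r * P \<omega>)\<^sup>2))"
    using L4_measurable[OF L4_scale[OF L4_Z]] L4_measurable[OF L4_scale[OF L4_P]]
      L4_integrable_power[OF L4_diff[OF L4_scale[OF L4_Z] L4_scale[OF L4_P]], of 2]
    by (intro char_diff_le_L2) auto
  also have "expectation (\<lambda>\<omega>. (u * Z \<omega> - r * P \<omega>)\<^sup>2) = 2 * (1 - sqrt (V / s))"
  proof -
    have "u\<^sup>2 * s = 1" "r\<^sup>2 * V = 1" using V s by (simp_all add: r u power_divide)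
    moreover have "u * r * V = sqrt (V / s)"
    proof -
      have "u * r * V = (V / sqrt V) / sqrt s" by (simp add: r u)
      also have "V / sqrt V = sqrt V" using V by (simp add: real_div_sqrt)
      finally show ?thesis by (simp add: real_sqrt_divide)
    qed
    ultimately show ?thesis
      by (simp add: expectation_scaled_remainder_square flip: V_def s_def) (simp add: left_diff_distrib)
  qed
  finally have 1: "cmod (char (distr N borel (\<lambda>\<omega>. u * Z \<omega>)) t - char (distr N borel (\<lambda>\<omega>. r * P \<omega>)) t)
      \<le> \<bar>t\<bar> * sqrt (2 * (1 - sqrt (V / s)))" .
  have 2: "cmod (char (distr N borel (\<lambda>\<omega>. r * P \<omega>)) t - exp (- (t\<^sup>2) / 2))
      \<le> (\<bar>t\<bar> ^ 3 / 6 + t ^ 4 / 8) * (r ^ 3 * (\<Sum>i=1..n. expectation (\<lambda>\<omega>. \<bar>Y i \<omega>\<bar> ^ 3)))"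
  proof -
    have "cmod (char (distr N borel (\<lambda>\<omega>. \<Sum>i=1..n. r * Y i \<omega>)) t - exp (- (t\<^sup>2) / 2))
        \<le> (\<bar>t\<bar> ^ 3 / 6 + t ^ 4 / 8) * (\<Sum>i=1..n. expectation (\<lambda>\<omega>. \<bar>r * Y i \<omega>\<bar> ^ 3))"
    proof (rule char_sum_normal_bound)
      show "indep_vars (\<lambda>_. borel) (\<lambda>i \<omega>. r * Y i \<omega>) {1..n}"
        by (rule indep_vars_compose2[OF indep_Y]) simp
      show "integrable N (\<lambda>\<omega>. \<bar>r * Y i \<omega>\<bar> ^ 3)" if "i \<in> {1..n}" for i
        by (rule L4_integrable_abs_power[OF L4_scale[OF L4_Y[OF that]]]) simp
      show "expectation (\<lambda>\<omega>. r * Y i \<omega>) = 0" if "i \<in> {1..n}" for i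
        using expectation_Y[OF that] by simp
      have "(\<Sum>i=1..n. expectation (\<lambda>\<omega>. (r * Y i \<omega>)\<^sup>2)) = r\<^sup>2 * V"
        by (simp add: power_mult_distrib V_def expectation_P_square sum_distrib_left)
      also have "\<dots> = 1" using V by (simp add: r power_divide)
      finally show "(\<Sum>i=1..n. expectation (\<lambda>\<omega>. (r * Y i \<omega>)\<^sup>2)) = 1" .
    qed simp
    then show ?thesis
      using r0 by (simp add: P_def sum_distrib_left abs_mult power_mult_distrib)
  qed
  have "cmod (char (distr N borel (\<lambda>\<omega>. u * Z \<omega>)) t - exp (- (t\<^sup>2) / 2))
      \<le> cmod (char (distr N borel (\<lambda>\<omega>. u * Z \<omega>)) t - char (distr N borel (\<lambda>\<omega>. r * P \<omega>)) t)
        + cmod (char (distr N borel (\<lambda>\<omega>. r * P \<omega>)) t - exp (- (t\<^sup>2) / 2))"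
    using norm_triangle_ineq[of "char (distr N borel (\<lambda>\<omega>. u * Z \<omega>)) t - char (distr N borel (\<lambda>\<omega>. r * P \<omega>)) t"
       "char (distr N borel (\<lambda>\<omega>. r * P \<omega>)) t - exp (- (t\<^sup>2) / 2)"] by simp
  then show ?thesis using 1 2 unfolding r3 u_def[symmetric] by linarith
qed

lemma variance_ratio_bound:
  assumes V: "V = variance (\<lambda>\<omega>. 1 / real n * (\<Sum>i=1..n. hproj N S X a h m n i (X i \<omega>)))" and pos: "V > 0"
  shows "\<bar>variance (ustat X a h m n) / V - 1\<bar>
     \<le> 17 * (real m + 1) * real m ^ (2 * m + 4)
        * (1 / real n ^ 2 * V powr (-1) * avg_weight a m 2 2 n * K powr (1 / 2))"
proof -
  have V': "V = expectation (\<lambda>\<omega>. (P \<omega>)\<^sup>2)" unfolding V by (rule variance_hproj)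
  have "\<bar>variance (ustat X a h m n) / V - 1\<bar> = \<bar>expectation (\<lambda>\<omega>. (Z \<omega>)\<^sup>2) - V\<bar> / V"
  proof -
    have "expectation (\<lambda>\<omega>. (Z \<omega>)\<^sup>2) / V - 1 = (expectation (\<lambda>\<omega>. (Z \<omega>)\<^sup>2) - V) / V"
      using pos by (simp add: diff_divide_distrib)
    then show ?thesis using pos by (simp add: variance_ustat abs_divide)
  qed
  also have "\<dots> \<le> 17 * (real m + 1) * real m ^ (2 * m + 4) * (1 / real n ^ 2 * avg_weight a m 2 2 n * K powr (1 / 2)) / V"
    using variance_gap_le pos unfolding V'[symmetric] by (intro divide_right_mono) simp_all
  also have "\<dots> = 17 * (real m + 1) * real m ^ (2 * m + 4)
        * (1 / real n ^ 2 * V powr (-1) * avg_weight a m 2 2 n * K powr (1 / 2))"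
    using pos by (simp add: powr_minus_divide)
  finally show ?thesis .
qed

lemma char_ustat_bound:
  assumes V: "V = variance (\<lambda>\<omega>. 1 / real n * (\<Sum>i=1..n. hproj N S X a h m n i (X i \<omega>)))" and pos: "V > 0"
  shows "cmod (char (distr N borel (\<lambda>\<omega>. variance (ustat X a h m n) powr (-1/2)
               * (ustat X a h m n \<omega> - expectation (ustat X a h m n)))) t - exp (- (t\<^sup>2) / 2))
     \<le> \<bar>t\<bar> * sqrt (2 * (1 - sqrt (V / variance (ustat X a h m n))))
       + (\<bar>t\<bar> ^ 3 / 6 + t ^ 4 / 8) * (51 * real m ^ (3 * m + 4)
          * (1 / real n ^ 2 * V powr (-3/2) * avg_weight a m 3 1 n * K powr (3 / 4)))"
proof -
  have V': "V = expectation (\<lambda>\<omega>. (P \<omega>)\<^sup>2)" unfolding V by (rule variance_hproj)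
  have "V powr (-3/2) * (\<Sum>i=1..n. expectation (\<lambda>\<omega>. \<bar>Y i \<omega>\<bar> ^ 3))
     \<le> V powr (-3/2) * (51 * real m ^ (3 * m + 4) * (1 / real n ^ 2 * avg_weight a m 3 1 n * K powr (3 / 4)))"
    by (intro mult_left_mono sum_third_moment_le) simp
  also have "\<dots> = 51 * real m ^ (3 * m + 4) * (1 / real n ^ 2 * V powr (-3/2) * avg_weight a m 3 1 n * K powr (3 / 4))"
    by simp
  finally have "(\<bar>t\<bar> ^ 3 / 6 + t ^ 4 / 8) * (V powr (-3/2) * (\<Sum>i=1..n. expectation (\<lambda>\<omega>. \<bar>Y i \<omega>\<bar> ^ 3)))
      \<le> (\<bar>t\<bar> ^ 3 / 6 + t ^ 4 / 8) * (51 * real m ^ (3 * m + 4)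
          * (1 / real n ^ 2 * V powr (-3/2) * avg_weight a m 3 1 n * K powr (3 / 4)))"
    by (rule mult_left_mono) simp
  then show ?thesis
    using char_normalized_bound[of t] pos
    unfolding ustat_centered V'[symmetric] by linarith
qed

end

section \<open>Asymptotic normality\<close>

theorem theorem2p1:
  fixes m :: nat
    and N :: "nat \<Rightarrow> 'w measure"
    and S :: "'x measure"
    and X :: "nat \<Rightarrow> nat \<Rightarrow> 'w \<Rightarrow> 'x"
    and a :: "nat \<Rightarrow> int list \<Rightarrow> real"
    and h :: "nat \<Rightarrow> 'x list \<Rightarrow> real"
    and M V :: "nat \<Rightarrow> real"
    and U :: "nat \<Rightarrow> 'w \<Rightarrow> real"
  assumes m: "m \<ge> 2"
    and prob: "\<And>n. prob_space (N n)"
    and indep: "\<And>n. prob_space.indep_vars (N n) (\<lambda>_. S) (X n) {1..n}"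
    and kernel: "\<And>n. kernel_measurable S m (h n)"
    and U: "\<And>n. U n = ustat (X n) (a n) (h n) m n"
    and V: "\<And>n. V n = prob_space.variance (N n)
                 (\<lambda>\<omega>. 1 / real n * (\<Sum>i=1..n. hproj (N n) S (X n) (a n) (h n) m n i (X n i \<omega>)))"
    and M_pos: "\<And>n. M n > 0"
    and moment_integrable: "\<And>n js. js \<in> dtuples {1..n} m \<Longrightarrow>
                 integrable (N n) (\<lambda>\<omega>. h n (map (\<lambda>j. X n j \<omega>) js) ^ 4)"
    and moment_bound: "\<And>n js. js \<in> dtuples {1..n} m \<Longrightarrow>
                 prob_space.expectation (N n) (\<lambda>\<omega>. h n (map (\<lambda>j. X n j \<omega>) js) ^ 4) \<le> M n"
    and V_pos: "eventually (\<lambda>n. V n > 0) sequentially"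
    and cond22: "(\<lambda>n. 1 / real n ^ 2 * V n powr (-1) * avg_weight (a n) m 2 2 n * M n powr (1/2))
                   \<longlonglongrightarrow> 0"
    and cond31: "(\<lambda>n. 1 / real n ^ 2 * V n powr (-3/2) * avg_weight (a n) m 3 1 n * M n powr (3/4))
                   \<longlonglongrightarrow> 0"
  shows "(\<lambda>n. prob_space.variance (N n) (U n) / V n) \<longlonglongrightarrow> 1 \<and>
         weak_conv_m
           (\<lambda>n. distr (N n) borel (\<lambda>\<omega>.
              prob_space.variance (N n) (U n) powr (-1/2) *
                (U n \<omega> - prob_space.expectation (N n) (U n))))
           std_normal_distribution"
proof
  define VU where "VU n = prob_space.variance (N n) (U n)" for n
  have sample: "indep_sample (N n) S (X n) n" for n
    by (intro indep_sample.intro indep_sample_axioms.intro prob indep)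
  have row: "weighted_ustat (N n) S (X n) n m (h n) (M n)" if "n \<ge> m" for n
    using m that kernel M_pos moment_integrable moment_bound
    by (intro weighted_ustat.intro sample weighted_ustat_axioms.intro)
      (simp_all add: indep_sample.obs_def[OF sample])
  (* A row with n < m has no tuples, so the bounds are available only for large n. *)
  have good: "\<forall>\<^sub>F n in sequentially. n \<ge> m \<and> V n > 0"
    using V_pos eventually_ge_at_top[of m] by eventually_elim simp
  have ratio: "(\<lambda>n. VU n / V n) \<longlonglongrightarrow> 1"
  proof (rule LIM_zero_cancel, rule Lim_null_comparison)
    show "\<forall>\<^sub>F n in sequentially. norm (VU n / V n - 1) \<le> 17 * (real m + 1) * real m ^ (2 * m + 4)
        * (1 / real n ^ 2 * V n powr (-1) * avg_weight (a n) m 2 2 n * M n powr (1/2))"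
      using good
    proof eventually_elim
      case (elim n)
      then show ?case
        using weighted_ustat.variance_ratio_bound[OF row V] by (simp only: VU_def U real_norm_def)
    qed
    show "(\<lambda>n. 17 * (real m + 1) * real m ^ (2 * m + 4)
        * (1 / real n ^ 2 * V n powr (-1) * avg_weight (a n) m 2 2 n * M n powr (1/2))) \<longlonglongrightarrow> 0"
      using tendsto_mult_right_zero[OF cond22] .
  qed
  then show "(\<lambda>n. prob_space.variance (N n) (U n) / V n) \<longlonglongrightarrow> 1"
    by (simp only: VU_def)
  have inv_ratio: "(\<lambda>n. V n / VU n) \<longlonglongrightarrow> 1"
    using tendsto_inverse[OF ratio] by simp
  show "weak_conv_m
           (\<lambda>n. distr (N n) borel (\<lambda>\<omega>.
              prob_space.variance (N n) (U n) powr (-1/2) *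
                (U n \<omega> - prob_space.expectation (N n) (U n))))
           std_normal_distribution"
  proof (rule levy_continuity)
    show "real_distribution (distr (N n) borel (\<lambda>\<omega>. prob_space.variance (N n) (U n) powr (-1/2) *
                (U n \<omega> - prob_space.expectation (N n) (U n))))" for n
    proof -
      have [measurable]: "U n \<in> borel_measurable (N n)"
        unfolding U by (rule indep_sample.ustat_measurable[OF sample kernel])
      show ?thesis
        by (rule prob_space.real_distribution_distr[OF prob]) measurable
    qed
    show "real_distribution std_normal_distribution" by (rule real_dist_normal_dist)
    fix t :: real
    let ?b = "\<lambda>n. \<bar>t\<bar> * sqrt (2 * (1 - sqrt (V n / VU n)))
       + (\<bar>t\<bar> ^ 3 / 6 + t ^ 4 / 8) * (51 * real m ^ (3 * m + 4)
          * (1 / real n ^ 2 * V n powr (-3/2) * avg_weight (a n) m 3 1 n * M n powr (3 / 4)))"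
    have "?b \<longlonglongrightarrow> \<bar>t\<bar> * sqrt (2 * (1 - sqrt 1)) + (\<bar>t\<bar> ^ 3 / 6 + t ^ 4 / 8) * (51 * real m ^ (3 * m + 4) * 0)"
      by (intro tendsto_intros inv_ratio cond31)
    then have lim: "?b \<longlonglongrightarrow> 0" by simp
    have "(\<lambda>n. char (distr (N n) borel (\<lambda>\<omega>. prob_space.variance (N n) (U n) powr (-1/2) *
                (U n \<omega> - prob_space.expectation (N n) (U n)))) t) \<longlonglongrightarrow> complex_of_real (exp (- (t\<^sup>2) / 2))"
    proof (rule LIM_zero_cancel, rule Lim_null_comparison[OF _ lim])
      show "\<forall>\<^sub>F n in sequentially. norm (char (distr (N n) borel (\<lambda>\<omega>. prob_space.variance (N n) (U n) powr (-1/2) *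
                (U n \<omega> - prob_space.expectation (N n) (U n)))) t - complex_of_real (exp (- (t\<^sup>2) / 2))) \<le> ?b n"
        using good
      proof eventually_elim
        case (elim n)
        then show ?case
          using weighted_ustat.char_ustat_bound[OF row V, of n t] by (simp only: VU_def U)
      qed
    qed
    then show "(\<lambda>n. char (distr (N n) borel (\<lambda>\<omega>. prob_space.variance (N n) (U n) powr (-1/2) *
                (U n \<omega> - prob_space.expectation (N n) (U n)))) t) \<longlonglongrightarrow> char std_normal_distribution t"
      by (simp only: char_std_normal_distribution)
  qed
qed

end
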